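(* Let $\xi,\xi_1,\xi_2,\ldots$ be independent identically distributed random variables with common distribution $F$, and let $\tau$ be a counting random variable (with values in $\{0,1,2,\ldots\}$) which does not depend on $\{\xi_n\}_{n\ge1}$. Assume that $\xi\ge0$ is heavy-tailed and $\mathbf{E}\xi<\infty$. Suppose there exists a function $f:\mathbf{R}^+\to\mathbf{R}$ such that $$\mathbf{E}e^{f(\xi)}=\infty$$ and, for some $c>\mathbf{E}\xi$, $$\mathbf{E}e^{f(c\tau)}<\infty .$$ If $f(x)\ge\ln x$ for all sufficiently large $x$ and if the difference $f(x)-\ln x$ is an eventually concave function, then $$\liminf_{x\to\infty}\frac{\overline{F^{*\tau}}(x)}{\overline F(x)}=\mathbf{E}\tau .$$
   Context: A random variable $\eta$ (or its distribution) is heavy-tailed if $\mathbf{E}e^{\varepsilon\eta}=\infty$ for all $\varepsilon>0$. For a distribution $H$ on the real line, $\overline H(x)=H((x,\infty))$. It is assumed that $F$ is unbounded from the right, that is, $\overline F(x)>0$ for all $x$, and that $\mathbf{E}\tau<\infty$. Put $S_0=0$, $S_n=\xi_1+\cdots+\xi_n$; $F^{*\tau}$ denotes the distribution of the random sum $S_\tau=\xi_1+\cdots+\xi_\tau$, so $\overline{F^{*\tau}}(x)=\mathbf{P}\{S_\tau>x\}$. Here $\mathbf{R}^+$ is the non-negative half-line, and a function is eventually concave if it is concave on $[x_0,\infty)$ for some $x_0$.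
   Formalization: The function f is additionally assumed bounded above on every bounded interval [0,b]; without this, E e^{f(ξ)} = ∞ can come from a local blow-up of f (e.g. f = ln x with a spike 1/|x−2| near 2, ξ Pareto with tail x^-3, τ with tail ~ x^-2), and the claim fails. *)

theory Defs
  imports "HOL-Probability.Probability"
begin

definition tail :: "real measure \<Rightarrow> real \<Rightarrow> real" where
  "tail H x = measure H {x<..}"

definition heavy_tailed :: "real measure \<Rightarrow> bool" where
  "heavy_tailed H \<longleftrightarrow> (\<forall>\<epsilon>>0. (\<integral>\<^sup>+ x. ennreal (exp (\<epsilon> * x)) \<partial>H) = \<infinity>)"

definition eventually_concave :: "(real \<Rightarrow> real) \<Rightarrow> bool" where
  "eventually_concave g \<longleftrightarrow> (\<exists>x0. concave_on {x0..} g)"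

definition partial_sum :: "(nat \<Rightarrow> 'a \<Rightarrow> real) \<Rightarrow> nat \<Rightarrow> 'a \<Rightarrow> real" where
  "partial_sum X n \<omega> = (\<Sum>i = 1..n. X i \<omega>)"

definition random_sum_distr ::
    "'a measure \<Rightarrow> (nat \<Rightarrow> 'a \<Rightarrow> real) \<Rightarrow> ('a \<Rightarrow> nat) \<Rightarrow> real measure" where
  "random_sum_distr M X \<tau> = distr M borel (\<lambda>\<omega>. partial_sum X (\<tau> \<omega>) \<omega>)"

text \<open>
  Independence of a counting variable from a whole sequence. The library's \<open>indep_var\<close>
  requires both variables to take values in the same type, so the independence of the two
  generated sigma-algebras is stated directly.
\<close>

definition indep_of_sequence ::
    "'a measure \<Rightarrow> ('a \<Rightarrow> nat) \<Rightarrow> (nat \<Rightarrow> 'a \<Rightarrow> real) \<Rightarrow> bool" where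
  "indep_of_sequence M \<tau> X \<longleftrightarrow>
     prob_space.indep_set M
       (sets (vimage_algebra (space M) \<tau> (count_space UNIV)))
       (sets (vimage_algebra (space M) (\<lambda>\<omega>. \<lambda>n\<in>{1..}. X n \<omega>) (\<Pi>\<^sub>M n\<in>{1..}. borel)))"

end

theory Submission
  imports Defs
begin

text \<open>
  The lower bound follows from dominated convergence in \<open>\<tau>\<close>, since a sum of \<open>n\<close> nonnegative terms
  exceeds \<open>x\<close> as soon as one of them does.

  For the upper bound assume that the tail of the random sum eventually dominates \<open>\<rho>\<close> times the tail
  of \<open>F\<close>, and test both against \<open>x * exp (h x)\<close> for concave \<open>h\<close> of the form
  \<open>min (\<theta> * x) (min (G x) s)\<close>, where \<open>G\<close> is essentially \<open>f - ln\<close>. The level \<open>s\<close> is chosen so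
  that \<open>I = \<integral> x * exp (h x) dF\<close> stays between a large constant \<open>K\<close> and \<open>exp 1 * K\<close> while
  \<open>\<theta>\<close> tends to 0. For small \<open>\<theta>\<close> the expectation of \<open>S\<^sub>n * exp (h S\<^sub>n)\<close> is at most
  \<open>I * n * exp (h (c * n))\<close>, so \<open>\<rho>\<close> is at most the expectation of \<open>\<tau> * exp (h (c * \<tau>))\<close> up to
  \<open>O(1 / K)\<close>. The latter tends to the expectation of \<open>\<tau>\<close>, with the integrable majorant
  \<open>\<tau> * exp (G (c * \<tau>))\<close>.
\<close>

subsection \<open>Comparing integrals through tails\<close>

text \<open>Each value \<open>\<phi> x\<close> is the length of \<open>{0..<\<phi> x}\<close>, so
  Tonelli exchanges the two integrations.\<close>

lemma nn_integral_layer_cake: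
  fixes \<phi> :: "'b \<Rightarrow> real"
  assumes "sigma_finite_measure N" and [measurable]: "\<phi> \<in> borel_measurable N"
    and nonneg: "\<And>x. 0 \<le> \<phi> x"
  shows "(\<integral>\<^sup>+x. ennreal (\<phi> x) \<partial>N)
    = (\<integral>\<^sup>+u. emeasure N {x \<in> space N. u < \<phi> x} * indicator {0..} u \<partial>lborel)"
proof -
  interpret N: sigma_finite_measure N by fact
  interpret pair_sigma_finite N lborel ..
  have "(\<integral>\<^sup>+x. ennreal (\<phi> x) \<partial>N)
    = (\<integral>\<^sup>+x. (\<integral>\<^sup>+u. indicator {u. 0 \<le> u \<and> u < \<phi> x} u \<partial>lborel) \<partial>N)"
  proof (intro nn_integral_cong)
    fix x
    have "{u. 0 \<le> u \<and> u < \<phi> x} = {0..<\<phi> x}" by auto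
    then show "ennreal (\<phi> x) = (\<integral>\<^sup>+u. indicator {u. 0 \<le> u \<and> u < \<phi> x} u \<partial>lborel)"
      using nonneg[of x] by simp
  qed
  also have "\<dots> = (\<integral>\<^sup>+u. (\<integral>\<^sup>+x. indicator {u. 0 \<le> u \<and> u < \<phi> x} u \<partial>N) \<partial>lborel)"
    by (rule Fubini'[symmetric]) (simp add: indicator_def, measurable)
  also have "\<dots> = (\<integral>\<^sup>+u. emeasure N {x \<in> space N. u < \<phi> x} * indicator {0..} u \<partial>lborel)"
  proof (intro nn_integral_cong)
    fix u :: real
    have "(\<integral>\<^sup>+x. indicator {u. 0 \<le> u \<and> u < \<phi> x} u \<partial>N)
      = (\<integral>\<^sup>+x. indicator {0..} u * indicator {x \<in> space N. u < \<phi> x} x \<partial>N)"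
      by (intro nn_integral_cong) (auto simp: indicator_def)
    also have "\<dots> = indicator {0..} u * emeasure N {x \<in> space N. u < \<phi> x}"
      by (subst nn_integral_cmult) auto
    finally show "(\<integral>\<^sup>+x. indicator {u. 0 \<le> u \<and> u < \<phi> x} u \<partial>N)
      = emeasure N {x \<in> space N. u < \<phi> x} * indicator {0..} u"
      by (simp add: mult.commute)
  qed
  finally show ?thesis .
qed

text \<open>Tails are measures of open rays only. Monotonicity makes a superlevel set upward closed
  and continuity makes it open, so closed rays do not occur. The bound \<open>y \<ge> x0\<close>
  serves comparisons valid only from \<open>x0\<close> on.\<close>

lemma mono_continuous_superlevel:
  fixes \<phi> :: "real \<Rightarrow> real"
  assumes "mono \<phi>" and cont: "continuous_on UNIV \<phi>" and "\<phi> x0 \<le> u"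
  obtains "{x. u < \<phi> x} = {}" | y where "y \<ge> x0" "{x. u < \<phi> x} = {y<..}"
proof (cases "{x. u < \<phi> x} = {}")
  case False
  let ?U = "{x. u < \<phi> x}"
  have lower: "x0 < x" if "x \<in> ?U" for x
    using that assms(3) monoD[OF \<open>mono \<phi>\<close>, of x x0] by (auto simp: not_less[symmetric])
  have bdd: "bdd_below ?U"
    using lower by (meson bdd_below.I less_imp_le)
  have "open ?U"
    using open_Collect_less[of "\<lambda>_. u" \<phi>] cont by auto
  have "Inf ?U \<notin> ?U"
  proof
    assume "Inf ?U \<in> ?U"
    with \<open>open ?U\<close> obtain e where e: "e > 0" "ball (Inf ?U) e \<subseteq> ?U"
      by (auto simp: open_contains_ball)
    have "Inf ?U - e/2 \<in> ball (Inf ?U) e" using e(1) by (simp add: dist_real_def)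
    then have "Inf ?U - e/2 \<in> ?U" using e(2) by blast
    then have "Inf ?U \<le> Inf ?U - e/2" by (rule cInf_lower[OF _ bdd])
    then show False using e(1) by simp
  qed
  have "?U = {Inf ?U<..}"
  proof (intro equalityI subsetI)
    fix x assume x: "x \<in> ?U"
    then have "Inf ?U \<le> x" by (rule cInf_lower[OF _ bdd])
    then show "x \<in> {Inf ?U<..}"
      using x \<open>Inf ?U \<notin> ?U\<close> by (cases "x = Inf ?U") auto
  next
    fix x assume "x \<in> {Inf ?U<..}"
    then obtain z where "z \<in> ?U" "z < x"
      using cInf_lessD[OF False, of x] by auto
    then show "x \<in> ?U" using monoD[OF \<open>mono \<phi>\<close>, of z x] by auto
  qed
  moreover have "x0 \<le> Inf ?U"
    using lower by (intro cInf_greatest[OF False]) (auto intro: less_imp_le)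
  ultimately show ?thesis using that(2) by blast
qed (use that(1) in blast)

text \<open>Layer cake turns a comparison of tails into one of integrals. Since tails are compared
  only beyond \<open>x0\<close>, the test function is replaced by \<open>\<psi>\<close>, which
  vanishes at \<open>x0\<close>: its superlevel sets at levels \<open>u \<ge> 0\<close> are empty or
  rays starting at or after \<open>x0\<close>. The term \<open>a * \<phi> x0\<close> pays for
  this.\<close>

lemma nn_integral_tail_dominated:
  fixes \<mu> \<nu> :: "real measure" and \<phi> :: "real \<Rightarrow> real"
  assumes "prob_space \<mu>" "prob_space \<nu>" and sets[measurable_cong]: "sets \<mu> = sets borel" "sets \<nu> = sets borel"
    and "mono \<phi>" and cont: "continuous_on UNIV \<phi>" and nonneg: "\<And>x. 0 \<le> \<phi> x"
    and "0 \<le> a"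
    and tail: "\<And>x. x \<ge> x0 \<Longrightarrow> a * measure \<nu> {x<..} \<le> measure \<mu> {x<..}"
  shows "ennreal a * (\<integral>\<^sup>+x. ennreal (\<phi> x) \<partial>\<nu>) \<le> (\<integral>\<^sup>+x. ennreal (\<phi> x) \<partial>\<mu>) + ennreal (a * \<phi> x0)"
proof -
  interpret \<mu>: prob_space \<mu> by fact
  interpret \<nu>: prob_space \<nu> by fact
  define \<psi> where "\<psi> x = max (\<phi> x - \<phi> x0) 0" for x
  have \<psi>: "mono \<psi>" "continuous_on UNIV \<psi>" "\<And>x. 0 \<le> \<psi> x" "\<psi> x0 = 0"
    using \<open>mono \<phi>\<close> unfolding \<psi>_def mono_def by (auto intro!: continuous_intros cont max.coboundedI1)
  have [measurable]: "\<phi> \<in> borel_measurable borel" "\<psi> \<in> borel_measurable borel"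
    using cont \<psi>(2) by (auto intro: borel_measurable_continuous_onI)
  have space: "space \<mu> = UNIV" "space \<nu> = UNIV"
    using sets by (auto dest: sets_eq_imp_space_eq)
  have level: "ennreal a * emeasure \<nu> {x. u < \<psi> x} \<le> emeasure \<mu> {x. u < \<psi> x}" if "u \<ge> 0" for u
  proof -
    from that have "\<psi> x0 \<le> u" using \<psi>(4) by simp
    from \<psi>(1,2) this show ?thesis
    proof (cases rule: mono_continuous_superlevel)
      case (2 y)
      then show ?thesis
        using tail[of y] \<open>0 \<le> a\<close>
        by (simp add: \<mu>.emeasure_eq_measure \<nu>.emeasure_eq_measure ennreal_mult'[symmetric])
    qed simp
  qed
  have "ennreal a * (\<integral>\<^sup>+x. ennreal (\<psi> x) \<partial>\<nu>)
      = (\<integral>\<^sup>+u. ennreal a * (emeasure \<nu> {x \<in> space \<nu>. u < \<psi> x} * indicator {0..} u) \<partial>lborel)"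
    using \<psi>(3) by (subst nn_integral_layer_cake) (auto simp: nn_integral_cmult \<nu>.sigma_finite_measure_axioms)
  also have "\<dots> \<le> (\<integral>\<^sup>+u. emeasure \<mu> {x \<in> space \<mu>. u < \<psi> x} * indicator {0..} u \<partial>lborel)"
    using level by (intro nn_integral_mono) (auto simp: space indicator_def)
  also have "\<dots> = (\<integral>\<^sup>+x. ennreal (\<psi> x) \<partial>\<mu>)"
    using \<psi>(3) by (subst nn_integral_layer_cake) (auto simp: \<mu>.sigma_finite_measure_axioms)
  also have "\<dots> \<le> (\<integral>\<^sup>+x. ennreal (\<phi> x) \<partial>\<mu>)"
    using nonneg by (intro nn_integral_mono ennreal_leI) (auto simp: \<psi>_def)
  finally have *: "ennreal a * (\<integral>\<^sup>+x. ennreal (\<psi> x) \<partial>\<nu>) \<le> (\<integral>\<^sup>+x. ennreal (\<phi> x) \<partial>\<mu>)" .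
  have "(\<integral>\<^sup>+x. ennreal (\<phi> x) \<partial>\<nu>) \<le> (\<integral>\<^sup>+x. ennreal (\<psi> x) + ennreal (\<phi> x0) \<partial>\<nu>)"
  proof (intro nn_integral_mono)
    fix x
    have "ennreal (\<phi> x) \<le> ennreal (\<psi> x + \<phi> x0)" by (intro ennreal_leI) (simp add: \<psi>_def)
    then show "ennreal (\<phi> x) \<le> ennreal (\<psi> x) + ennreal (\<phi> x0)"
      using nonneg[of x0] \<psi>(3)[of x] by simp
  qed
  also have "\<dots> = (\<integral>\<^sup>+x. ennreal (\<psi> x) \<partial>\<nu>) + ennreal (\<phi> x0)"
    by (subst nn_integral_add) (auto simp: \<nu>.emeasure_space_1)
  finally have "ennreal a * (\<integral>\<^sup>+x. ennreal (\<phi> x) \<partial>\<nu>)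
      \<le> ennreal a * ((\<integral>\<^sup>+x. ennreal (\<psi> x) \<partial>\<nu>) + ennreal (\<phi> x0))"
    by (intro mult_left_mono) auto
  also have "\<dots> \<le> (\<integral>\<^sup>+x. ennreal (\<phi> x) \<partial>\<mu>) + ennreal (a * \<phi> x0)"
    using * \<open>0 \<le> a\<close> nonneg[of x0] by (simp add: distrib_left ennreal_mult)
  finally show ?thesis .
qed

subsection \<open>Concave functions on the half-line\<close>

text \<open>By concavity between \<open>0\<close> and \<open>x + y\<close>, each of
  \<open>h x\<close> and \<open>h y\<close> is at least its proportional share of
  \<open>h (x + y)\<close>.\<close>

lemma concave_on_subadditive:
  fixes h :: "real \<Rightarrow> real"
  assumes h: "concave_on {0..} h" "0 \<le> h 0" and "0 \<le> x" "0 \<le> y"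
  shows "h (x + y) \<le> h x + h y"
proof (cases "x + y = 0")
  case True
  then show ?thesis using assms by (simp add: add_nonneg_eq_0_iff)
next
  case False
  then have pos: "x + y > 0" using assms by simp
  have part: "h z \<ge> z / (x + y) * h (x + y)" if "0 \<le> z" "z \<le> x + y" for z
  proof -
    have "(1 - z/(x+y)) * h 0 + z/(x+y) * h (x+y) \<le> h ((1 - z/(x+y)) *\<^sub>R 0 + (z/(x+y)) *\<^sub>R (x+y))"
      using that pos assms by (intro concave_onD[OF h(1)]) auto
    moreover have "0 \<le> (1 - z/(x+y)) * h 0"
      using that pos h(2) by (intro mult_nonneg_nonneg) auto
    ultimately show ?thesis using pos by simp
  qed
  have "h (x + y) = x / (x + y) * h (x + y) + y / (x + y) * h (x + y)"
    using pos by (simp add: distrib_right[symmetric] add_divide_distrib[symmetric])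
  also have "\<dots> \<le> h x + h y" using part[of x] part[of y] assms by simp
  finally show ?thesis .
qed

lemma concave_on_subadditive_sum:
  fixes h :: "real \<Rightarrow> real"
  assumes h: "concave_on {0..} h" "h 0 = 0" and "finite I" "\<And>i. i \<in> I \<Longrightarrow> 0 \<le> x i"
  shows "h (\<Sum>i\<in>I. x i) \<le> (\<Sum>i\<in>I. h (x i))"
  using assms(3,4)
proof (induction I)
  case (insert i I)
  have "h (x i + (\<Sum>i\<in>I. x i)) \<le> h (x i) + h (\<Sum>i\<in>I. x i)"
    using insert.prems h by (intro concave_on_subadditive) (auto intro: sum_nonneg)
  then show ?case using insert by simp
qed (use h in simp)

lemma concave_on_min:
  fixes f g :: "real \<Rightarrow> real"
  assumes "concave_on S f" "concave_on S g"
  shows "concave_on S (\<lambda>x. min (f x) (g x))"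
  unfolding concave_on_iff
proof (intro conjI allI ballI impI)
  show "convex S" using assms(1) by (rule concave_on_imp_convex)
  fix x y u v :: real assume *: "x \<in> S" "y \<in> S" "0 \<le> u" "0 \<le> v" "u + v = 1"
  have "u * min (f x) (g x) + v * min (f y) (g y) \<le> u * f x + v * f y"
    using * by (intro add_mono mult_left_mono) auto
  also have "\<dots> \<le> f (u *\<^sub>R x + v *\<^sub>R y)" using * assms(1) by (auto simp: concave_on_iff)
  finally have 1: "u * min (f x) (g x) + v * min (f y) (g y) \<le> f (u *\<^sub>R x + v *\<^sub>R y)" .
  have "u * min (f x) (g x) + v * min (f y) (g y) \<le> u * g x + v * g y"
    using * by (intro add_mono mult_left_mono) auto
  also have "\<dots> \<le> g (u *\<^sub>R x + v *\<^sub>R y)" using * assms(2) by (auto simp: concave_on_iff)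
  finally show "u * min (f x) (g x) + v * min (f y) (g y) \<le> min (f (u *\<^sub>R x + v *\<^sub>R y)) (g (u *\<^sub>R x + v *\<^sub>R y))"
    using 1 by simp
qed

text \<open>The slope is the right derivative of \<open>h\<close> at \<open>z\<close>, expressed
  through the convex function \<open>- h\<close>. Comparison at \<open>z + 1\<close> and
  monotonicity give its sign.\<close>

lemma concave_supergradient:
  fixes h :: "real \<Rightarrow> real"
  assumes h: "concave_on {0..} h" "mono h" and "0 < z"
  obtains \<theta> where "0 \<le> \<theta>" "\<And>x. 0 \<le> x \<Longrightarrow> h x \<le> h z + \<theta> * (x - z)"
proof -
  define \<theta> where "\<theta> = - Inf ((\<lambda>t. (- h z - - h t) / (z - t)) ` ({z<..} \<inter> {0..}))"
  have *: "h x \<le> h z + \<theta> * (x - z)" if "0 \<le> x" for x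
    using convex_le_Inf_differential[of "{0..}" "\<lambda>x. - h x" z x] h(1) that \<open>0 < z\<close>
    unfolding \<theta>_def concave_on_def by auto
  have "h z \<le> h (z + 1)" using h(2) by (simp add: monoD)
  with *[of "z + 1"] \<open>0 < z\<close> have "0 \<le> \<theta>" by simp
  with * show ?thesis using that by blast
qed

text \<open>A concave function that has once decreased stays below a line of negative slope and
  would become negative.\<close>

lemma concave_nonneg_imp_mono_on:
  fixes g :: "real \<Rightarrow> real"
  assumes g: "concave_on {a..} g" and nonneg: "\<And>x. a \<le> x \<Longrightarrow> 0 \<le> g x"
  shows "mono_on {a..} g"
proof (rule mono_onI, rule ccontr)
  fix u v assume uv: "u \<in> {a..}" "v \<in> {a..}" "u \<le> v" and "\<not> g u \<le> g v"
  then have less: "g v < g u" by simp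
  have gv: "0 \<le> g v" using nonneg uv by simp
  \<comment> \<open>This weight makes \<open>(1 - t) * g u\<close> the mean of \<open>g u\<close>
    and \<open>g v\<close>, which exceeds \<open>g v\<close>. With \<open>v\<close> at proportion
    \<open>t\<close> on the way from \<open>u\<close> to \<open>w\<close>, concavity would force
    \<open>g w < 0\<close>.\<close>
  define t where "t = (g u - g v) / (2 * g u)"
  have t: "0 < t" "t \<le> 1" using less gv by (auto simp: t_def field_simps)
  define w where "w = u + (v - u) / t"
  have "0 \<le> (v - u) / t" using uv t by (intro divide_nonneg_pos) auto
  then have w: "a \<le> w" unfolding w_def using uv(1) by simp
  have "(1 - t) * g u + t * g w \<le> g ((1 - t) *\<^sub>R u + t *\<^sub>R w)"
    using t uv w by (intro concave_onD[OF g]) auto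
  also have "(1 - t) *\<^sub>R u + t *\<^sub>R w = v" using t by (simp add: w_def field_simps)
  finally have v: "(1 - t) * g u + t * g w \<le> g v" .
  have "(1 - t) * g u = (g u + g v) / 2" using less gv by (simp add: t_def field_simps)
  with v have "(g u + g v) / 2 + t * g w \<le> g v" by (simp only:)
  moreover have "0 \<le> t * g w" using t nonneg[OF w] by simp
  ultimately have "(g u + g v) / 2 \<le> g v" by (metis add_increasing2 order_refl order_trans)
  then show False using less by simp
qed

lemma concave_on_shift:
  fixes g :: "real \<Rightarrow> real"
  assumes "concave_on {a..} g"
  shows "concave_on {0..} (\<lambda>x. g (x + a))"
  unfolding concave_on_iff
proof (intro conjI allI ballI impI)
  fix x y u v :: real assume *: "x \<in> {0..}" "y \<in> {0..}" "0 \<le> u" "0 \<le> v" "u + v = 1"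
  have "u * g (x + a) + v * g (y + a) \<le> g (u *\<^sub>R (x + a) + v *\<^sub>R (y + a))"
    using assms * by (auto simp: concave_on_iff)
  also have "u *\<^sub>R (x + a) + v *\<^sub>R (y + a) = u *\<^sub>R x + v *\<^sub>R y + (u + v) * a"
    by (simp add: algebra_simps)
  finally show "u * g (x + a) + v * g (y + a) \<le> g (u *\<^sub>R x + v *\<^sub>R y + a)" using * by simp
qed simp

text \<open>
  Shifting \<open>f - ln\<close> past the point where it becomes concave and nonnegative gives an everywhere
  concave \<open>G\<close> such that \<open>x * exp (G x)\<close> and \<open>exp (f x)\<close> are comparable in both directions.
\<close>
lemma eventually_concave_comparison:
  fixes f :: "real \<Rightarrow> real"
  assumes bdd: "\<And>b. bdd_above (f ` {0..b})"
    and ge_ln: "eventually (\<lambda>x. f x \<ge> ln x) at_top"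
    and conc: "eventually_concave (\<lambda>x. f x - ln x)"
  obtains G A C where "concave_on {0..} G" "mono G" "continuous_on UNIV G" "G 0 = 0" "0 \<le> A" "0 \<le> C"
    "\<And>x. 0 \<le> x \<Longrightarrow> exp (f x) \<le> A + C * (x * exp (G x))"
    "\<And>x. 0 \<le> x \<Longrightarrow> x * exp (G x) \<le> A + C * exp (f x)"
proof -
  define g where "g = (\<lambda>x. f x - ln x)"
  obtain x0 where x0: "concave_on {x0..} g"
    using conc unfolding eventually_concave_def g_def by blast
  obtain x1 where x1: "\<And>x. x1 \<le> x \<Longrightarrow> ln x \<le> f x"
    using ge_ln by (auto simp: eventually_at_top_linorder)
  \<comment> \<open>The bound \<open>x0 + 1\<close> puts \<open>a\<close> strictly inside the region
    of concavity, so that continuity includes the end point \<open>a\<close>; the bound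
    \<open>1\<close> gives \<open>exp (ln x) = x\<close> from \<open>a\<close> on.\<close>
  define a where "a = max 1 (max (x0 + 1) x1)"
  have a: "1 \<le> a" "x0 < a" "x1 \<le> a" by (auto simp: a_def)
  have g_conc: "concave_on {a..} g"
    using x0 a unfolding concave_on_def by (elim convex_on_subset) auto
  have g_nonneg: "0 \<le> g x" if "a \<le> x" for x using x1[of x] that a by (simp add: g_def)
  have g_mono: "mono_on {a..} g"
    by (rule concave_nonneg_imp_mono_on[OF g_conc g_nonneg])
  have "convex_on {x0<..} (\<lambda>x. - g x)"
    using x0 unfolding concave_on_def by (elim convex_on_subset) auto
  then have "continuous_on {x0<..} (\<lambda>x. - g x)" by (intro convex_on_continuous) auto
  then have "continuous_on {x0<..} g" using continuous_on_minus by fastforce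
  then have g_cont: "continuous_on {a..} g" using a by (elim continuous_on_subset) auto
  \<comment> \<open>Freezing the argument on the negative axis makes \<open>G\<close> monotone and
    continuous on the whole line; subtracting \<open>g a\<close> normalizes
    \<open>G 0 = 0\<close>.\<close>
  define G where "G x = g (max x 0 + a) - g a" for x
  have G_conc: "concave_on {0..} G"
  proof -
    have "concave_on {0..} (\<lambda>x. g (x + a) - g a)"
      using concave_on_shift[OF g_conc] by (intro concave_on_diff) (auto simp: convex_on_const)
    moreover have "concave_on {0..} G \<longleftrightarrow> concave_on {0..} (\<lambda>x. g (x + a) - g a)"
      unfolding concave_on_iff G_def by (intro conj_cong refl ball_cong all_cong imp_cong) (auto simp: max_absorb1)
    ultimately show ?thesis by simp
  qed
  have G_mono: "mono G"
    unfolding G_def by (intro monoI diff_right_mono mono_onD[OF g_mono]) auto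
  have G_cont: "continuous_on UNIV G"
    unfolding G_def by (intro continuous_intros continuous_on_compose2[OF g_cont]) auto
  have G0: "G 0 = 0" by (simp add: G_def)
  have G_nonneg: "0 \<le> G x" if "0 \<le> x" for x using monoD[OF G_mono that] G0 by simp
  have exp_f: "exp (f x) = x * exp (g x)" if "a \<le> x" for x
    using that a by (simp add: g_def exp_diff)
  obtain B where "\<forall>y\<in>f ` {0..a}. y \<le> B"
    using bdd[of a] unfolding bdd_above_def by blast
  then have B: "f x \<le> B" if "0 \<le> x" "x \<le> a" for x using that by simp
  \<comment> \<open>\<open>A\<close> covers both left-hand sides on the interval from
    \<open>0\<close> to \<open>a\<close>; \<open>C\<close> covers the factors lost by the shift
    beyond \<open>a\<close>.\<close>
  define A where "A = max (exp B) (a * exp (G a))"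
  define C where "C = max (exp (g a)) (exp (G a))"
  have AC: "0 \<le> A" "0 \<le> C" by (auto simp: A_def C_def le_max_iff_disj)
  have 1: "exp (f x) \<le> A + C * (x * exp (G x))" if x: "0 \<le> x" for x
  proof (cases "x \<le> a")
    case True
    then have "exp (f x) \<le> A" using B[OF x True] by (simp add: A_def le_max_iff_disj)
    then show ?thesis using AC x by (intro order_trans[OF _ le_add_same_cancel1[THEN iffD2]]) auto
  next
    case False
    have "g x \<le> g (x + a)" using False a by (intro mono_onD[OF g_mono]) auto
    then have "g x \<le> g a + G x" using x by (simp add: G_def)
    then have "exp (f x) \<le> x * exp (g a + G x)" using False x exp_f[of x] by (simp add: mult_left_mono)
    also have "\<dots> = exp (g a) * (x * exp (G x))" by (simp add: exp_add)
    also have "\<dots> \<le> C * (x * exp (G x))" using x by (intro mult_right_mono) (auto simp: C_def)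
    finally show ?thesis using AC by simp
  qed
  have 2: "x * exp (G x) \<le> A + C * exp (f x)" if x: "0 \<le> x" for x
  proof (cases "x \<le> a")
    case True
    have "x * exp (G x) \<le> a * exp (G a)" using True x a monoD[OF G_mono True] by (intro mult_mono) auto
    also have "\<dots> \<le> A" by (simp add: A_def)
    finally show ?thesis using AC by (simp add: add_increasing2)
  next
    case False
    \<comment> \<open>Subadditivity undoes the shift at the cost of the constant
      \<open>G a\<close>.\<close>
    have "G ((x - a) + a) \<le> G (x - a) + G a"
      using False a G0 by (intro concave_on_subadditive[OF G_conc]) auto
    also have "G (x - a) = g x - g a" using False by (simp add: G_def)
    finally have "G x \<le> G a + g x" using g_nonneg[of a] by simp
    then have "x * exp (G x) \<le> x * exp (G a + g x)" using x by (intro mult_left_mono) auto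
    also have "\<dots> = exp (G a) * exp (f x)" using False exp_f[of x] by (simp add: exp_add)
    also have "\<dots> \<le> C * exp (f x)" by (intro mult_right_mono) (auto simp: C_def)
    finally show ?thesis using AC by simp
  qed
  from that[OF G_conc G_mono G_cont G0 AC 1 2] show ?thesis .
qed

subsection \<open>Exponential moments along concave functions\<close>

lemma exp_minus_one_le:
  fixes h :: real
  shows "exp h - 1 \<le> h * exp h"
proof -
  have "(1 - h) * exp h \<le> exp (- h) * exp h"
    using exp_ge_add_one_self[of "- h"] by (intro mult_right_mono) auto
  also have "\<dots> = 1" by (simp add: exp_minus)
  finally show ?thesis by (simp add: left_diff_distrib)
qed

text \<open>
  The contributions to \<open>exp h - 1\<close> are split according to the size of \<open>h\<close>: below \<open>\<delta>\<close> the
  exponential is almost linear, above \<open>B\<close> it is controlled by \<open>\<integral> x * exp (h x)\<close>, and the middle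
  range only sees \<open>x > \<delta> / \<theta>\<close>, where the first moment is small.
\<close>
lemma exp_minus_one_split:
  fixes h x \<theta> \<delta> B :: real
  assumes "0 \<le> h" "h \<le> \<theta> * x" "0 \<le> x" "0 < \<theta>" "0 < \<delta>" "0 < B"
  shows "exp h - 1 \<le> \<theta> * (exp \<delta> * x + exp B * (x * indicator {\<delta> / \<theta><..} x) + x * exp h / B)"
proof -
  have nonneg: "0 \<le> exp \<delta> * x" "0 \<le> exp B * (x * indicator {\<delta> / \<theta><..} x)" "0 \<le> x * exp h / B"
    using assms by (auto intro!: mult_nonneg_nonneg)
  consider "h \<le> \<delta>" | "\<delta> < h" "h \<le> B" | "B < h" by linarith
  then have "exp h - 1 \<le> \<theta> * (exp \<delta> * x) \<or>
      exp h - 1 \<le> \<theta> * (exp B * (x * indicator {\<delta> / \<theta><..} x)) \<or> exp h - 1 \<le> \<theta> * (x * exp h / B)"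
  proof cases
    case 1
    have "h * exp h \<le> (\<theta> * x) * exp \<delta>" using assms 1 by (intro mult_mono) auto
    then show ?thesis using exp_minus_one_le[of h] by (simp add: mult_ac)
  next
    case 2
    have "h * exp h \<le> (\<theta> * x) * exp B" using assms 2 by (intro mult_mono) auto
    moreover have "\<delta> / \<theta> < x" using assms 2 by (simp add: pos_divide_less_eq mult.commute)
    ultimately show ?thesis using exp_minus_one_le[of h] by (simp add: mult_ac)
  next
    case 3
    have "1 * exp h \<le> (h / B) * exp h" using assms 3 by (intro mult_right_mono) auto
    then have "exp h \<le> (h / B) * exp h" by simp
    also have "\<dots> \<le> (\<theta> * x / B) * exp h" using assms by (intro mult_right_mono divide_right_mono) auto
    finally show ?thesis by (simp add: mult_ac)
  qed
  then show ?thesis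
  proof (elim disjE)
    assume "exp h - 1 \<le> \<theta> * (exp \<delta> * x)"
    also have "\<dots> \<le> \<theta> * (exp \<delta> * x + exp B * (x * indicator {\<delta> / \<theta><..} x) + x * exp h / B)"
      using nonneg assms by (intro mult_left_mono) auto
    finally show ?thesis .
  next
    assume "exp h - 1 \<le> \<theta> * (exp B * (x * indicator {\<delta> / \<theta><..} x))"
    also have "\<dots> \<le> \<theta> * (exp \<delta> * x + exp B * (x * indicator {\<delta> / \<theta><..} x) + x * exp h / B)"
      using nonneg assms by (intro mult_left_mono) auto
    finally show ?thesis .
  next
    assume "exp h - 1 \<le> \<theta> * (x * exp h / B)"
    also have "\<dots> \<le> \<theta> * (exp \<delta> * x + exp B * (x * indicator {\<delta> / \<theta><..} x) + x * exp h / B)"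
      using nonneg assms by (intro mult_left_mono) auto
    finally show ?thesis .
  qed
qed

lemma integral_tail_tendsto_0:
  fixes F :: "real measure"
  assumes sets[measurable_cong]: "sets F = sets borel" and int: "integrable F (\<lambda>x. x)"
  shows "((\<lambda>y. \<integral>x. x * indicator {y<..} x \<partial>F) \<longlongrightarrow> 0) at_top"
proof -
  have "((\<lambda>y. \<integral>x. x * indicator {y<..} x \<partial>F) \<longlongrightarrow> (\<integral>x. 0 \<partial>F)) at_top"
  proof (rule integral_dominated_convergence_at_top[where w="\<lambda>x. \<bar>x\<bar>"])
    have "((\<lambda>y. x * indicator {y<..} x) \<longlongrightarrow> 0) at_top" for x :: real
    proof (rule tendsto_eventually, use eventually_ge_at_top[of x] in eventually_elim)
      case (elim y)
      then show ?case by (simp add: indicator_def)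
    qed
    then show "AE x in F. ((\<lambda>y. x * indicator {y<..} x) \<longlongrightarrow> 0) at_top" by simp
    show "\<forall>\<^sub>F y in at_top. AE x in F. norm (x * indicator {y<..} x) \<le> \<bar>x\<bar>"
      by (intro always_eventually allI AE_I2) (simp add: indicator_def)
    show "integrable F (\<lambda>x. \<bar>x\<bar>)" using int by (rule integrable_abs)
  qed measurable
  then show ?thesis by simp
qed

text \<open>Integrating the pointwise split bounds the exponential moment by
  \<open>1 + \<theta>\<close> times a bracket. Choosing \<open>\<delta>\<close>, \<open>B\<close>
  and \<open>\<theta>\<^sub>0\<close> in this order makes the bracket at most \<open>c\<close>, and
  \<open>1 + \<theta> * c \<le> exp (\<theta> * c)\<close>. As \<open>\<theta>\<^sub>0\<close>
  depends only on \<open>F\<close>, \<open>c\<close> and \<open>K\<close>, it serves all admissible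
  \<open>h\<close> at once.\<close>

lemma exp_moment_le:
  fixes F :: "real measure"
  assumes "prob_space F" and sets[measurable_cong]: "sets F = sets borel"
    and nonneg: "AE x in F. 0 \<le> x" and int: "integrable F (\<lambda>x. x)"
    and c: "(\<integral>x. x \<partial>F) < c" and "0 \<le> K"
  obtains \<theta>\<^sub>0 where "0 < \<theta>\<^sub>0"
    "\<And>\<theta> h. \<lbrakk>0 \<le> \<theta>; \<theta> \<le> \<theta>\<^sub>0; h \<in> borel_measurable borel; \<And>x. 0 \<le> x \<Longrightarrow> 0 \<le> h x \<and> h x \<le> \<theta> * x;
        (\<integral>\<^sup>+x. ennreal (x * exp (h x)) \<partial>F) \<le> ennreal K\<rbrakk>
      \<Longrightarrow> (\<integral>\<^sup>+x. ennreal (exp (h x)) \<partial>F) \<le> ennreal (exp (\<theta> * c))"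
proof -
  interpret F: prob_space F by fact
  define m where "m = (\<integral>x. x \<partial>F)"
  \<comment> \<open>The gap between the mean and \<open>c\<close> is shared equally by the three
    error terms.\<close>
  define \<eta> where "\<eta> = (c - m) / 3"
  have m: "0 \<le> m" unfolding m_def using nonneg by (rule integral_nonneg_AE)
  have \<eta>: "0 < \<eta>" using c by (simp add: \<eta>_def m_def)
  \<comment> \<open>Solves \<open>exp \<delta> * (m + \<eta> / 2) = m + \<eta>\<close>; the summand
    \<open>\<eta> / 2\<close> keeps the denominator positive when \<open>m = 0\<close>.\<close>
  define \<delta> where "\<delta> = ln ((m + \<eta>) / (m + \<eta> / 2))"
  have \<delta>: "0 < \<delta>" unfolding \<delta>_def using m \<eta> by (intro ln_gt_zero) (simp add: field_simps)
  have "exp \<delta> * m \<le> exp \<delta> * (m + \<eta> / 2)" using \<eta> by (intro mult_left_mono) auto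
  also have "\<dots> = m + \<eta>" using m \<eta> unfolding \<delta>_def by (subst exp_ln) (auto simp: field_simps intro!: divide_pos_pos)
  finally have A: "exp \<delta> * m \<le> m + \<eta>" .
  define B where "B = K / \<eta> + 1"
  have B: "0 < B" "K / B \<le> \<eta>"
  proof -
    show "0 < B" using \<open>0 \<le> K\<close> \<eta> by (simp add: B_def add_nonneg_pos)
    moreover have "\<eta> * B = K + \<eta>" using \<eta> by (simp add: B_def field_simps)
    ultimately show "K / B \<le> \<eta>" using \<eta> by (simp add: pos_divide_le_eq)
  qed
  define T where "T y = (\<integral>x. x * indicator {y<..} x \<partial>F)" for y :: real
  have "\<forall>\<^sub>F y in at_top. T y < \<eta> / exp B"
    unfolding T_def by (rule order_tendstoD(2)[OF integral_tail_tendsto_0[OF sets int]]) (use \<eta> in simp)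
  then obtain y0 where y0: "\<And>y. y0 \<le> y \<Longrightarrow> T y < \<eta> / exp B"
    by (auto simp: eventually_at_top_linorder)
  \<comment> \<open>For positive slopes up to this value the cut-off
    \<open>\<delta> / \<theta>\<close> is at least \<open>y0\<close>, so the middle term contributes
    at most \<open>\<eta>\<close>.\<close>
  define \<theta>\<^sub>0 where "\<theta>\<^sub>0 = \<delta> / max y0 1"
  show ?thesis
  proof (rule that[of \<theta>\<^sub>0])
    show "0 < \<theta>\<^sub>0" using \<delta> by (simp add: \<theta>\<^sub>0_def)
    fix \<theta> h
    assume \<theta>: "0 \<le> \<theta>" "\<theta> \<le> \<theta>\<^sub>0" and [measurable]: "h \<in> borel_measurable borel"
      and h: "\<And>x. 0 \<le> x \<Longrightarrow> 0 \<le> h x \<and> h x \<le> \<theta> * x"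
      and K: "(\<integral>\<^sup>+x. ennreal (x * exp (h x)) \<partial>F) \<le> ennreal K"
    show "(\<integral>\<^sup>+x. ennreal (exp (h x)) \<partial>F) \<le> ennreal (exp (\<theta> * c))"
    \<comment> \<open>At slope zero the cut-off \<open>\<delta> / \<theta>\<close> is meaningless,
      but then \<open>h\<close> vanishes on the half-line.\<close>
    proof (cases "\<theta> = 0")
      case True
      have "(\<integral>\<^sup>+x. ennreal (exp (h x)) \<partial>F) = (\<integral>\<^sup>+x. 1 \<partial>F)"
      proof (intro nn_integral_cong_AE, use nonneg in eventually_elim)
        case (elim x)
        then show ?case using h[of x] True by simp
      qed
      then show ?thesis using True by (simp add: F.emeasure_space_1)
    next
      case False
      with \<theta> have "0 < \<theta>" by simp
      have int_K: "integrable F (\<lambda>x. x * exp (h x))"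
      proof (rule integrableI_nonneg)
        show "AE x in F. 0 \<le> x * exp (h x)" using nonneg by eventually_elim simp
        show "(\<integral>\<^sup>+x. ennreal (x * exp (h x)) \<partial>F) < \<infinity>"
          using le_less_trans[OF K ennreal_less_top] by simp
      qed simp
      have le_K: "(\<integral>x. x * exp (h x) \<partial>F) \<le> K"
      proof -
        have "AE x in F. 0 \<le> x * exp (h x)" using nonneg by eventually_elim simp
        with K have "ennreal (\<integral>x. x * exp (h x) \<partial>F) \<le> ennreal K"
          using nn_integral_eq_integral[OF int_K] by simp
        then show ?thesis using \<open>0 \<le> K\<close> by (simp add: ennreal_le_iff)
      qed
      have "y0 \<le> \<delta> / \<theta>"
      proof -
        have "\<theta> * max y0 1 \<le> \<delta>"
          using \<theta>(2) by (simp add: \<theta>\<^sub>0_def pos_le_divide_eq)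
        then have "max y0 1 \<le> \<delta> / \<theta>" using \<open>0 < \<theta>\<close> by (subst pos_le_divide_eq) (simp_all add: mult.commute)
        then show ?thesis by simp
      qed
      then have T: "exp B * T (\<delta> / \<theta>) \<le> \<eta>" using y0[of "\<delta> / \<theta>"] by (simp add: field_simps)
      define R where "R x = 1 + \<theta> * (exp \<delta> * x + exp B * (x * indicator {\<delta> / \<theta><..} x) + x * exp (h x) / B)" for x
      have int_T: "integrable F (\<lambda>x. x * indicator {\<delta> / \<theta><..} x)"
        using int by (intro integrable_real_mult_indicator) auto
      have int_R: "integrable F R"
        unfolding R_def using int int_T int_K by auto
      have R: "AE x in F. exp (h x) \<le> R x"
        using nonneg
      proof eventually_elim
        case (elim x)
        then show ?case
          using exp_minus_one_split[of "h x" \<theta> x \<delta> B] h[of x] \<open>0 < \<theta>\<close> \<delta> B by (simp add: R_def)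
      qed
      have "(\<integral>\<^sup>+x. ennreal (exp (h x)) \<partial>F) \<le> (\<integral>\<^sup>+x. ennreal (R x) \<partial>F)"
        by (intro nn_integral_mono_AE, use R in eventually_elim) (rule ennreal_leI)
      also have "\<dots> = ennreal (\<integral>x. R x \<partial>F)"
      proof (intro nn_integral_eq_integral int_R, use R in eventually_elim)
        fix x assume "exp (h x) \<le> R x"
        then show "0 \<le> R x" using exp_ge_zero[of "h x"] by linarith
      qed
      also have "(\<integral>x. R x \<partial>F) = 1 + \<theta> * (exp \<delta> * m + exp B * T (\<delta> / \<theta>) + (\<integral>x. x * exp (h x) \<partial>F) / B)"
        unfolding R_def m_def T_def using int int_T int_K by (simp add: F.prob_space)
      also have "\<dots> \<le> 1 + \<theta> * ((m + \<eta>) + \<eta> + K / B)"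
        using A T le_K B(1) \<open>0 < \<theta>\<close> by (intro add_left_mono mult_left_mono add_mono divide_right_mono) auto
      also have "\<dots> \<le> 1 + \<theta> * c"
      proof (intro add_left_mono mult_left_mono)
        have "c = m + 3 * \<eta>" unfolding \<eta>_def by argo
        then show "(m + \<eta>) + \<eta> + K / B \<le> c" using B(2) by linarith
      qed (use \<theta> in simp)
      also have "\<dots> \<le> exp (\<theta> * c)" by simp
      finally show ?thesis by (simp add: ennreal_leI)
    qed
  qed
qed

text \<open>If \<open>G\<close> is below the line \<open>\<theta> * x\<close> at some positive
  point, concavity and \<open>G 0 = 0\<close> keep it below from there on, and the divergence comes
  from \<open>top\<close>. Otherwise the minimum is the line itself, and heavy-tailedness applies.
  In both cases a function \<open>\<psi>\<close> of infinite integral exceeds the integrand by at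
  most a constant.\<close>

lemma nn_integral_exp_min_linear_eq_top:
  fixes F :: "real measure" and G :: "real \<Rightarrow> real"
  assumes "prob_space F" and sets[measurable_cong]: "sets F = sets borel"
    and nonneg: "AE x in F. 0 \<le> x"
    and heavy: "heavy_tailed F"
    and G: "concave_on {0..} G" "mono G" "G 0 = 0"
    and top: "(\<integral>\<^sup>+x. ennreal (x * exp (G x)) \<partial>F) = \<infinity>"
    and "0 < \<theta>"
  shows "(\<integral>\<^sup>+x. ennreal (x * exp (min (\<theta> * x) (G x))) \<partial>F) = \<infinity>"
proof -
  interpret F: prob_space F by fact
  have [measurable]: "G \<in> borel_measurable borel" using G(2) by (rule borel_measurable_mono)
  obtain \<psi> D where \<psi>: "(\<integral>\<^sup>+x. ennreal (\<psi> x) \<partial>F) = \<infinity>" and D: "0 \<le> D"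
    and le: "\<And>x. 0 \<le> x \<Longrightarrow> \<psi> x \<le> x * exp (min (\<theta> * x) (G x)) + D"
  proof (cases "\<exists>x>0. G x < \<theta> * x")
    case True
    then obtain x where x: "0 < x" "G x < \<theta> * x" by blast
    have "G y \<le> \<theta> * y" if "x \<le> y" for y
    proof -
      have "(1 - x/y) * G 0 + x/y * G y \<le> G ((1 - x/y) *\<^sub>R 0 + (x/y) *\<^sub>R y)"
        using that x by (intro concave_onD[OF G(1)]) auto
      then have "x * G y \<le> G x * y" using that x G(3) by (simp add: field_simps)
      also have "\<dots> \<le> (\<theta> * x) * y" using that x by (intro mult_right_mono) auto
      finally show ?thesis using x by (simp add: mult_ac)
    qed
    then have "y * exp (G y) \<le> y * exp (min (\<theta> * y) (G y)) + x * exp (G x)" if "0 \<le> y" for y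
    proof (cases "x \<le> y")
      case False
      then have "y * exp (G y) \<le> x * exp (G x)"
        using that monoD[OF G(2), of y x] by (intro mult_mono) auto
      then show ?thesis using that by (simp add: add_increasing)
    qed (use x in \<open>auto simp: min_absorb2\<close>)
    then show ?thesis using that[OF top, of "x * exp (G x)"] x by simp
  next
    case False
    have "exp (\<theta> * y) \<le> y * exp (min (\<theta> * y) (G y)) + exp \<theta>" if "0 \<le> y" for y
    proof -
      have "\<theta> * x \<le> G x" if "0 < x" for x using False that by (meson not_less)
      then have "\<theta> * y \<le> G y" using that G(3) by (cases "y = 0") auto
      \<comment> \<open>Heavy-tailedness has no factor \<open>y\<close> in front of the exponential;
        inserting it costs a constant, as only \<open>y \<le> 1\<close> matters.\<close>
      moreover have "exp (\<theta> * y) \<le> y * exp (\<theta> * y) + exp \<theta>"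
      proof (cases "y \<le> 1")
        case True
        then have "exp (\<theta> * y) \<le> exp \<theta>" using \<open>0 < \<theta>\<close> by simp
        then show ?thesis using that by (simp add: add_increasing)
      next
        case False
        then have "1 * exp (\<theta> * y) \<le> y * exp (\<theta> * y)" by (intro mult_right_mono) auto
        then show ?thesis using exp_ge_zero[of \<theta>] by linarith
      qed
      ultimately show ?thesis by (simp add: min_absorb1)
    qed
    then show ?thesis using that[of "\<lambda>y. exp (\<theta> * y)" "exp \<theta>"] heavy \<open>0 < \<theta>\<close> by (simp add: heavy_tailed_def)
  qed
  have "\<infinity> \<le> (\<integral>\<^sup>+x. ennreal (x * exp (min (\<theta> * x) (G x))) + ennreal D \<partial>F)"
    unfolding \<psi>[symmetric]
  proof (intro nn_integral_mono_AE, use nonneg in eventually_elim)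
    case (elim x)
    have "ennreal (\<psi> x) \<le> ennreal (x * exp (min (\<theta> * x) (G x)) + D)" by (intro ennreal_leI le elim)
    then show ?case using elim D by simp
  qed
  also have "\<dots> = (\<integral>\<^sup>+x. ennreal (x * exp (min (\<theta> * x) (G x))) \<partial>F) + ennreal D"
    by (subst nn_integral_add) (auto simp: F.emeasure_space_1)
  finally show ?thesis by (simp add: top_unique)
qed

text \<open>
  Truncating at successive integers increases the integral by a factor of at most \<open>exp 1\<close> in each
  step, so it cannot jump over the interval from \<open>K\<close> to \<open>exp 1 * K\<close>.
\<close>
lemma truncation_level_exists:
  fixes F :: "real measure" and H :: "real \<Rightarrow> real"
  assumes "prob_space F" and sets[measurable_cong]: "sets F = sets borel"
    and nonneg: "AE x in F. 0 \<le> x" and int: "integrable F (\<lambda>x. x)"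
    and H[measurable]: "H \<in> borel_measurable borel" and H_nonneg: "\<And>x. 0 \<le> x \<Longrightarrow> 0 \<le> H x"
    and top: "(\<integral>\<^sup>+x. ennreal (x * exp (H x)) \<partial>F) = \<infinity>"
    and K: "(\<integral>x. x \<partial>F) \<le> K" "0 \<le> K"
  obtains s :: nat where "ennreal K \<le> (\<integral>\<^sup>+x. ennreal (x * exp (min (H x) (real s))) \<partial>F)"
    "(\<integral>\<^sup>+x. ennreal (x * exp (min (H x) (real s))) \<partial>F) \<le> ennreal (exp 1 * K)"
proof -
  interpret F: prob_space F by fact
  define I where "I s = (\<integral>\<^sup>+x. ennreal (x * exp (min (H x) (real s))) \<partial>F)" for s :: nat
  \<comment> \<open>If every level stayed below \<open>K\<close>, monotone convergence would make
    the untruncated integral finite.\<close>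
  have "\<exists>s. ennreal K \<le> I s"
  proof (rule ccontr)
    assume "\<not> ?thesis"
    then have bound: "I s \<le> ennreal K" for s by (simp add: not_le less_imp_le)
    have "(\<integral>\<^sup>+x. ennreal (x * exp (H x)) \<partial>F) = (\<integral>\<^sup>+x. (SUP s. ennreal (x * exp (min (H x) (real s)))) \<partial>F)"
    proof (intro nn_integral_cong antisym)
      fix x :: real
      obtain s :: nat where "H x \<le> real s" using real_arch_simple by blast
      then have "ennreal (x * exp (H x)) = ennreal (x * exp (min (H x) (real s)))" by simp
      then show "ennreal (x * exp (H x)) \<le> (SUP s. ennreal (x * exp (min (H x) (real s))))"
        by (metis SUP_upper UNIV_I)
      show "(SUP s. ennreal (x * exp (min (H x) (real s)))) \<le> ennreal (x * exp (H x))"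
      proof (rule SUP_least)
        fix s
        show "ennreal (x * exp (min (H x) (real s))) \<le> ennreal (x * exp (H x))"
          by (cases "0 \<le> x") (auto intro!: ennreal_leI mult_left_mono simp: ennreal_neg mult_nonpos_nonneg)
      qed
    qed
    also have "\<dots> = (SUP s. I s)"
      unfolding I_def
    proof (rule nn_integral_monotone_convergence_SUP)
      show "incseq (\<lambda>s x. ennreal (x * exp (min (H x) (real s))))"
      proof (intro monoI le_funI)
        fix s t :: nat and x :: real assume "s \<le> t"
        then show "ennreal (x * exp (min (H x) (real s))) \<le> ennreal (x * exp (min (H x) (real t)))"
          by (cases "0 \<le> x") (auto intro!: ennreal_leI mult_left_mono min.mono simp: ennreal_neg mult_nonpos_nonneg)
      qed
    qed measurable
    also have "\<dots> \<le> ennreal K" by (intro SUP_least bound)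
    finally show False using top by (simp add: top_unique)
  qed
  then obtain s where s: "ennreal K \<le> I s" and least: "\<And>t. t < s \<Longrightarrow> I t \<le> ennreal K"
    using LeastI_ex[of "\<lambda>s. ennreal K \<le> I s"] not_less_Least[of _ "\<lambda>s. ennreal K \<le> I s"]
    by (metis linear)
  have "I s \<le> ennreal (exp 1 * K)"
  proof (cases s)
    case 0
    \<comment> \<open>At level 0 the exponential factor is 1 on the half-line, so the integral is
      the mean, which is at most \<open>K\<close>.\<close>
    have "I 0 = (\<integral>\<^sup>+x. ennreal x \<partial>F)"
      unfolding I_def using nonneg by (intro nn_integral_cong_AE) (auto simp: H_nonneg min_absorb2 elim!: eventually_mono)
    also have "\<dots> = ennreal (\<integral>x. x \<partial>F)" using int nonneg by (rule nn_integral_eq_integral)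
    also have "\<dots> \<le> ennreal (exp 1 * K)"
    proof (rule ennreal_leI)
      have "1 * K \<le> exp 1 * K" using K(2) by (intro mult_right_mono) auto
      then show "(\<integral>x. x \<partial>F) \<le> exp 1 * K" using K(1) by simp
    qed
    finally show ?thesis using 0 by simp
  next
    case (Suc t)
    have "I s \<le> (\<integral>\<^sup>+x. ennreal (exp 1) * ennreal (x * exp (min (H x) (real t))) \<partial>F)"
      unfolding I_def
    proof (intro nn_integral_mono_AE, use nonneg in eventually_elim)
      case (elim x)
      have "x * exp (min (H x) (real s)) \<le> x * exp (1 + min (H x) (real t))"
        using elim Suc by (intro mult_left_mono) auto
      also have "\<dots> = exp 1 * (x * exp (min (H x) (real t)))" by (simp add: exp_add)
      finally have "ennreal (x * exp (min (H x) (real s))) \<le> ennreal (exp 1 * (x * exp (min (H x) (real t))))"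
        by (rule ennreal_leI)
      then show ?case using elim by (simp add: ennreal_mult)
    qed
    also have "\<dots> = ennreal (exp 1) * I t" unfolding I_def by (rule nn_integral_cmult) measurable
    also have "\<dots> \<le> ennreal (exp 1) * ennreal K" using least[of t] Suc by (intro mult_left_mono) auto
    also have "\<dots> = ennreal (exp 1 * K)" using K by (simp add: ennreal_mult)
    finally show ?thesis .
  qed
  with s show ?thesis using that unfolding I_def by blast
qed

subsection \<open>Random sums\<close>

text \<open>
  The function \<open>h\<close> lies below its tangent at \<open>c * n\<close>, of slope \<open>\<theta>\<close>, and also below
  \<open>h (c * n) - \<theta> * (c * n) + min (\<theta> * x) (h x)\<close>. The latter bound is subadditive up to the additive
  constant, so the expectation factorises and the constant is compensated by the factors
  \<open>exp (\<theta> * c)\<close>.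
\<close>
lemma (in prob_space) nn_integral_iid_sum_exp_concave_le:
  fixes X :: "nat \<Rightarrow> 'a \<Rightarrow> real" and h :: "real \<Rightarrow> real"
  assumes indep: "indep_vars (\<lambda>_. borel) X {1..n}"
    and distr: "\<And>i. i \<in> {1..n} \<Longrightarrow> distr M borel (X i) = F"
    and nonneg: "AE x in F. 0 \<le> x"
    and h: "concave_on {0..} h" "mono h" "h 0 = 0" "\<And>x. 0 \<le> x \<Longrightarrow> h x \<le> \<theta>\<^sub>0 * x"
    and "0 \<le> K" "0 < c"
    and K: "(\<integral>\<^sup>+x. ennreal (x * exp (h x)) \<partial>F) \<le> ennreal K"
    and exp_moment: "\<And>\<theta> h. \<lbrakk>0 \<le> \<theta>; \<theta> \<le> \<theta>\<^sub>0; h \<in> borel_measurable borel;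
        \<And>x. 0 \<le> x \<Longrightarrow> 0 \<le> h x \<and> h x \<le> \<theta> * x;
        (\<integral>\<^sup>+x. ennreal (x * exp (h x)) \<partial>F) \<le> ennreal K\<rbrakk>
      \<Longrightarrow> (\<integral>\<^sup>+x. ennreal (exp (h x)) \<partial>F) \<le> ennreal (exp (\<theta> * c))"
  shows "(\<integral>\<^sup>+\<omega>. ennreal ((\<Sum>i=1..n. X i \<omega>) * exp (h (\<Sum>i=1..n. X i \<omega>))) \<partial>M)
    \<le> ennreal (K * (real n * exp (h (c * real n))))"
proof (cases "n = 0")
  case False
  define z where "z = c * real n"
  have "0 < z" using False \<open>0 < c\<close> by (simp add: z_def)
  obtain \<theta> where \<theta>: "0 \<le> \<theta>" and tangent: "\<And>x. 0 \<le> x \<Longrightarrow> h x \<le> h z + \<theta> * (x - z)"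
    using concave_supergradient[OF h(1,2) \<open>0 < z\<close>] by blast
  have [measurable]: "h \<in> borel_measurable borel" using h(2) by (rule borel_measurable_mono)
  have rv[measurable]: "X i \<in> borel_measurable M" if "i \<in> {1..n}" for i
    using indep that by (auto simp: indep_vars_def)
  have h_nonneg: "0 \<le> h x" if "0 \<le> x" for x
    using monoD[OF h(2) that] h(3) by simp
  \<comment> \<open>The value of the tangent at the origin, nonnegative because
    \<open>h 0 = 0\<close>. Hence the slope is at most \<open>h z / z\<close>, and so at most
    \<open>\<theta>\<^sub>0\<close>.\<close>
  define b where "b = h z - \<theta> * z"
  have b: "0 \<le> b" using tangent[of 0] h(3) by (simp add: b_def algebra_simps)
  have "\<theta> * z \<le> \<theta>\<^sub>0 * z" using b h(4)[of z] \<open>0 < z\<close> unfolding b_def by linarith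
  then have \<theta>_le: "\<theta> \<le> \<theta>\<^sub>0" using \<open>0 < z\<close> by (rule mult_right_le_imp_le)
  define k where "k x = min (\<theta> * x) (h x)" for x
  have k: "concave_on {0..} k" "k 0 = 0"
    unfolding k_def using \<theta> h(1,3) by (auto intro!: concave_on_min concave_on_cmul simp: concave_on_ident)
  have [measurable]: "k \<in> borel_measurable borel" unfolding k_def by measurable
  have h_le_k: "h x \<le> b + k x" if "0 \<le> x" for x
    using tangent[OF that] b by (auto simp: b_def k_def algebra_simps min_def)
  have k_moment: "(\<integral>\<^sup>+x. ennreal (exp (k x)) \<partial>F) \<le> ennreal (exp (\<theta> * c))"
  proof (rule exp_moment[OF \<theta> \<theta>_le])
    show "0 \<le> k x \<and> k x \<le> \<theta> * x" if "0 \<le> x" for x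
      using that \<theta> h_nonneg by (simp add: k_def)
    have "(\<integral>\<^sup>+x. ennreal (x * exp (k x)) \<partial>F) \<le> (\<integral>\<^sup>+x. ennreal (x * exp (h x)) \<partial>F)"
      by (intro nn_integral_mono_AE, use nonneg in eventually_elim)
        (auto intro!: ennreal_leI mult_left_mono simp: k_def)
    with K show "(\<integral>\<^sup>+x. ennreal (x * exp (k x)) \<partial>F) \<le> ennreal K" by simp
  qed measurable
  \<comment> \<open>In the \<open>i\<close>-th term of the expanded sum, summand \<open>i\<close>
    carries the weight \<open>x * exp (h x)\<close> and all other summands carry only
    \<open>exp (k x)\<close>.\<close>
  define Y where "Y i j x = (if j = i then ennreal (x * exp (h x)) else ennreal (exp (k x)))"
    for i j :: nat and x :: real
  have Y[measurable]: "Y i j \<in> borel_measurable borel" for i j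
    unfolding Y_def by (cases "j = i") auto
  have AE_nonneg: "AE \<omega> in M. 0 \<le> X i \<omega>" if "i \<in> {1..n}" for i
  proof -
    have "AE x in distr M borel (X i). 0 \<le> x"
      unfolding distr[OF that] by (rule nonneg)
    then show ?thesis using rv[OF that] by (simp add: AE_distr_iff)
  qed
  then have AE_all: "AE \<omega> in M. \<forall>i\<in>{1..n}. 0 \<le> X i \<omega>"
    by (simp add: AE_finite_all)
  \<comment> \<open>One summand \<open>x\<close> is split off by subadditivity of \<open>h\<close>;
    only the rest \<open>r\<close> is passed to \<open>k\<close>, so \<open>exp b\<close> is paid
    once for the whole rest.\<close>
  have step: "x * exp (h (x + r)) \<le> exp b * (x * exp (h x) * exp (k r))" if "0 \<le> x" "0 \<le> r" for x r
  proof -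
    have "h (x + r) \<le> h x + h r" using that h by (intro concave_on_subadditive) auto
    also have "\<dots> \<le> b + h x + k r" using h_le_k[of r] that by simp
    finally have "x * exp (h (x + r)) \<le> x * exp (b + h x + k r)"
      using that by (intro mult_left_mono) auto
    then show ?thesis by (simp add: exp_add mult_ac)
  qed
  have bound: "ennreal ((\<Sum>i=1..n. X i \<omega>) * exp (h (\<Sum>i=1..n. X i \<omega>)))
      \<le> (\<Sum>i=1..n. ennreal (exp b) * (\<Prod>j=1..n. Y i j (X j \<omega>)))" if pos: "\<forall>i\<in>{1..n}. 0 \<le> X i \<omega>" for \<omega>
  proof -
    let ?S = "\<Sum>i=1..n. X i \<omega>"
    have "ennreal (?S * exp (h ?S)) = (\<Sum>i=1..n. ennreal (X i \<omega> * exp (h ?S)))"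
      using pos by (subst sum_ennreal) (auto simp: sum_distrib_right)
    also have "\<dots> \<le> (\<Sum>i=1..n. ennreal (exp b) * (\<Prod>j=1..n. Y i j (X j \<omega>)))"
    proof (intro sum_mono)
      fix i assume i: "i \<in> {1..n}"
      let ?J = "{1..n} - {i}"
      let ?r = "\<Sum>j\<in>?J. X j \<omega>"
      have r: "0 \<le> ?r" using pos by (intro sum_nonneg) auto
      have "exp (k ?r) \<le> exp (\<Sum>j\<in>?J. k (X j \<omega>))"
        unfolding exp_le_cancel_iff using pos by (intro concave_on_subadditive_sum[OF k]) auto
      also have "\<dots> = (\<Prod>j\<in>?J. exp (k (X j \<omega>)))" by (simp add: exp_sum)
      finally have k_prod: "exp (k ?r) \<le> (\<Prod>j\<in>?J. exp (k (X j \<omega>)))" .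
      have "?S = X i \<omega> + ?r" using i by (simp add: sum.remove)
      then have "X i \<omega> * exp (h ?S) \<le> exp b * (X i \<omega> * exp (h (X i \<omega>)) * exp (k ?r))"
        using step[of "X i \<omega>" ?r] pos i r by simp
      also have "\<dots> \<le> exp b * (X i \<omega> * exp (h (X i \<omega>)) * (\<Prod>j\<in>?J. exp (k (X j \<omega>))))"
        using pos i k_prod by (intro mult_left_mono) auto
      finally have "ennreal (X i \<omega> * exp (h ?S))
          \<le> ennreal (exp b * (X i \<omega> * exp (h (X i \<omega>)) * (\<Prod>j\<in>?J. exp (k (X j \<omega>)))))"
        by (rule ennreal_leI)
      also have "\<dots> = ennreal (exp b) * (ennreal (X i \<omega> * exp (h (X i \<omega>))) * (\<Prod>j\<in>?J. ennreal (exp (k (X j \<omega>)))))"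
        using pos i by (simp add: ennreal_mult prod_ennreal prod_nonneg)
      also have "(\<Prod>j\<in>?J. ennreal (exp (k (X j \<omega>)))) = (\<Prod>j\<in>?J. Y i j (X j \<omega>))"
        by (intro prod.cong) (auto simp: Y_def)
      also have "ennreal (X i \<omega> * exp (h (X i \<omega>))) = Y i i (X i \<omega>)" by (simp add: Y_def)
      also have "Y i i (X i \<omega>) * (\<Prod>j\<in>?J. Y i j (X j \<omega>)) = (\<Prod>j=1..n. Y i j (X j \<omega>))"
        using i by (simp add: prod.remove)
      finally show "ennreal (X i \<omega> * exp (h ?S)) \<le> ennreal (exp b) * (\<Prod>j=1..n. Y i j (X j \<omega>))" .
    qed
    finally show ?thesis .
  qed
  have prod_le: "(\<integral>\<^sup>+\<omega>. (\<Prod>j=1..n. Y i j (X j \<omega>)) \<partial>M) \<le> ennreal (K * exp (\<theta> * z))" if i: "i \<in> {1..n}" for i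
  proof -
    have Y_int: "(\<integral>\<^sup>+\<omega>. Y i j (X j \<omega>) \<partial>M) = (\<integral>\<^sup>+x. Y i j x \<partial>F)" if "j \<in> {1..n}" for j
      using distr[OF that, symmetric] rv[OF that] by (simp add: nn_integral_distr)
    have "(\<integral>\<^sup>+\<omega>. (\<Prod>j=1..n. Y i j (X j \<omega>)) \<partial>M) = (\<Prod>j=1..n. \<integral>\<^sup>+\<omega>. Y i j (X j \<omega>) \<partial>M)"
      by (intro indep_vars_nn_integral indep_vars_compose2[OF indep]) auto
    also have "\<dots> = (\<Prod>j=1..n. \<integral>\<^sup>+x. Y i j x \<partial>F)"
      using Y_int by (intro prod.cong) auto
    also have "\<dots> = (\<integral>\<^sup>+x. Y i i x \<partial>F) * (\<Prod>j\<in>{1..n} - {i}. \<integral>\<^sup>+x. Y i j x \<partial>F)"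
      using i by (simp add: prod.remove)
    also have "\<dots> \<le> ennreal K * (\<Prod>j\<in>{1..n} - {i}. ennreal (exp (\<theta> * c)))"
      using K k_moment by (intro mult_mono prod_mono_ennreal) (auto simp: Y_def)
    also have "\<dots> = ennreal (K * exp (\<theta> * c) ^ (n - 1))"
      using i \<open>0 \<le> K\<close> by (simp add: ennreal_mult ennreal_power)
    \<comment> \<open>A further factor, at least 1, completes the power to
      \<open>exp (\<theta> * z)\<close>. This cancels the term \<open>- \<theta> * z\<close> in
      \<open>b\<close> and leaves \<open>exp (h z)\<close>.\<close>
    also have "\<dots> \<le> ennreal (K * exp (\<theta> * c) ^ n)"
      using \<open>0 \<le> K\<close> \<theta> \<open>0 < c\<close> by (intro ennreal_leI mult_left_mono power_increasing) auto
    also have "exp (\<theta> * c) ^ n = exp (\<theta> * z)"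
      by (simp add: z_def exp_of_nat_mult[symmetric] mult_ac)
    finally show ?thesis .
  qed
  have "(\<integral>\<^sup>+\<omega>. ennreal ((\<Sum>i=1..n. X i \<omega>) * exp (h (\<Sum>i=1..n. X i \<omega>))) \<partial>M)
      \<le> (\<integral>\<^sup>+\<omega>. (\<Sum>i=1..n. ennreal (exp b) * (\<Prod>j=1..n. Y i j (X j \<omega>))) \<partial>M)"
    by (intro nn_integral_mono_AE, use AE_all in eventually_elim) (rule bound)
  also have "\<dots> = (\<Sum>i=1..n. ennreal (exp b) * (\<integral>\<^sup>+\<omega>. (\<Prod>j=1..n. Y i j (X j \<omega>)) \<partial>M))"
    by (subst nn_integral_sum) (auto intro!: sum.cong nn_integral_cmult)
  also have "\<dots> \<le> (\<Sum>i=1..n. ennreal (exp b) * ennreal (K * exp (\<theta> * z)))"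
    using prod_le by (intro sum_mono mult_left_mono) auto
  also have "\<dots> = ennreal (real n * (exp b * (K * exp (\<theta> * z))))"
    using \<open>0 \<le> K\<close> by (simp add: ennreal_mult ennreal_of_nat_eq_real_of_nat)
  also have "real n * (exp b * (K * exp (\<theta> * z))) = K * (real n * exp (h z))"
    by (simp add: b_def exp_diff)
  finally show ?thesis by (simp add: z_def)
qed simp

section \<open>Conditioning on the counting variable\<close>

lemma (in prob_space) random_sum_distr_eq_bind:
  fixes X :: "nat \<Rightarrow> 'a \<Rightarrow> real" and \<tau> :: "'a \<Rightarrow> nat"
  assumes rv: "\<And>n. n \<ge> 1 \<Longrightarrow> X n \<in> borel_measurable M"
    and \<tau>[measurable]: "\<tau> \<in> measurable M (count_space UNIV)"
    and indep: "indep_of_sequence M \<tau> X"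
  shows "random_sum_distr M X \<tau>
    = distr M (count_space UNIV) \<tau> \<bind> (\<lambda>n. distr M borel (partial_sum X n))"
proof -
  have S[measurable]: "partial_sum X n \<in> borel_measurable M" for n
    unfolding partial_sum_def using rv by (intro borel_measurable_sum) auto
  have S_tau[measurable]: "(\<lambda>\<omega>. partial_sum X (\<tau> \<omega>) \<omega>) \<in> borel_measurable M"
    by (rule measurable_compose_countable) auto
  have kernel: "(\<lambda>n. distr M borel (partial_sum X n)) \<in> measurable (distr M (count_space UNIV) \<tau>) (subprob_algebra borel)"
    by (auto simp: space_subprob_algebra intro!: prob_space_imp_subprob_space prob_space_distr)
  \<comment> \<open>For a fixed number \<open>n\<close> of summands, the event on
    \<open>\<tau>\<close> and the event on the partial sum lie in the two independent
    sigma-algebras; the latter because \<open>partial_sum X n\<close> is a measurable function of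
    the coordinates from 1 to \<open>n\<close>.\<close>
  have joint: "emeasure M {\<omega>\<in>space M. \<tau> \<omega> = n \<and> partial_sum X n \<omega> \<in> B}
      = emeasure M {\<omega>\<in>space M. \<tau> \<omega> = n} * emeasure M {\<omega>\<in>space M. partial_sum X n \<omega> \<in> B}"
    if [measurable]: "B \<in> sets borel" for n B
  proof -
    let ?X = "\<lambda>\<omega>. \<lambda>n\<in>{1..}. X n \<omega>"
    let ?P = "\<Pi>\<^sub>M n\<in>{1::nat..}. (borel :: real measure)"
    let ?T = "sets (vimage_algebra (space M) \<tau> (count_space UNIV))"
    let ?V = "sets (vimage_algebra (space M) ?X ?P)"
    have T: "{\<omega>\<in>space M. \<tau> \<omega> = n} \<in> ?T"
      by (subst sets_vimage_algebra2) (auto intro!: exI[of _ "{n}"])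
    have "(\<lambda>y. \<Sum>i=1..n. y i) \<in> borel_measurable ?P"
      by (intro borel_measurable_sum measurable_component_singleton) auto
    then have "{y \<in> space ?P. (\<Sum>i=1..n. y i) \<in> B} \<in> sets ?P" by measurable
    moreover have "{\<omega>\<in>space M. partial_sum X n \<omega> \<in> B} = ?X -` {y \<in> space ?P. (\<Sum>i=1..n. y i) \<in> B} \<inter> space M"
      by (auto simp: partial_sum_def space_PiM PiE_def cong: sum.cong_simp)
    moreover have "?V = {?X -` A \<inter> space M | A. A \<in> sets ?P}"
      by (rule sets_vimage_algebra2) (auto simp: space_PiM)
    ultimately have V: "{\<omega>\<in>space M. partial_sum X n \<omega> \<in> B} \<in> ?V" by blast
    have "{\<omega>\<in>space M. \<tau> \<omega> = n \<and> partial_sum X n \<omega> \<in> B}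
        = {\<omega>\<in>space M. \<tau> \<omega> = n} \<inter> {\<omega>\<in>space M. partial_sum X n \<omega> \<in> B}" by auto
    then have "prob {\<omega>\<in>space M. \<tau> \<omega> = n \<and> partial_sum X n \<omega> \<in> B}
        = prob {\<omega>\<in>space M. \<tau> \<omega> = n} * prob {\<omega>\<in>space M. partial_sum X n \<omega> \<in> B}"
      using indep_setD[OF indep[unfolded indep_of_sequence_def] T V] by simp
    then show ?thesis by (simp add: emeasure_eq_measure ennreal_mult)
  qed
  show ?thesis
  proof (rule measure_eqI)
    show "sets (random_sum_distr M X \<tau>) = sets (distr M (count_space UNIV) \<tau> \<bind> (\<lambda>n. distr M borel (partial_sum X n)))"
      by (subst sets_bind[where N=borel]) (auto simp: random_sum_distr_def not_empty)
    fix B assume "B \<in> sets (random_sum_distr M X \<tau>)"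
    then have B[measurable]: "B \<in> sets borel" by (simp add: random_sum_distr_def)
    have "emeasure (random_sum_distr M X \<tau>) B = emeasure M {\<omega>\<in>space M. partial_sum X (\<tau> \<omega>) \<omega> \<in> B}"
      unfolding random_sum_distr_def by (subst emeasure_distr) (auto intro!: arg_cong[where f="emeasure M"])
    also have "{\<omega>\<in>space M. partial_sum X (\<tau> \<omega>) \<omega> \<in> B} = (\<Union>n. {\<omega>\<in>space M. \<tau> \<omega> = n \<and> partial_sum X n \<omega> \<in> B})"
      by auto
    also have "emeasure M \<dots> = (\<Sum>n. emeasure M {\<omega>\<in>space M. \<tau> \<omega> = n \<and> partial_sum X n \<omega> \<in> B})"
      by (intro suminf_emeasure[symmetric]) (auto simp: disjoint_family_on_def)
    \<comment> \<open>The probability of \<open>\<tau> = n\<close> is written as the integral of an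
      indicator, so that after exchanging sum and integral only the term
      \<open>n = \<tau> \<omega>\<close> remains.\<close>
    also have "\<dots> = (\<Sum>n. \<integral>\<^sup>+\<omega>. emeasure M {\<omega>\<in>space M. partial_sum X n \<omega> \<in> B} * indicator {\<omega>\<in>space M. \<tau> \<omega> = n} \<omega> \<partial>M)"
      by (subst nn_integral_cmult_indicator) (auto simp: joint[OF B] mult.commute)
    also have "\<dots> = (\<integral>\<^sup>+\<omega>. (\<Sum>n. emeasure M {\<omega>\<in>space M. partial_sum X n \<omega> \<in> B} * indicator {\<omega>\<in>space M. \<tau> \<omega> = n} \<omega>) \<partial>M)"
      by (intro nn_integral_suminf[symmetric]) measurable
    also have "\<dots> = (\<integral>\<^sup>+\<omega>. emeasure (distr M borel (partial_sum X (\<tau> \<omega>))) B \<partial>M)"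
    proof (intro nn_integral_cong)
      fix \<omega> assume \<omega>: "\<omega> \<in> space M"
      have "(\<Sum>n. emeasure M {\<omega>\<in>space M. partial_sum X n \<omega> \<in> B} * indicator {\<omega>\<in>space M. \<tau> \<omega> = n} \<omega>)
          = (\<Sum>n\<in>{\<tau> \<omega>}. emeasure M {\<omega>\<in>space M. partial_sum X n \<omega> \<in> B} * indicator {\<omega>\<in>space M. \<tau> \<omega> = n} \<omega>)"
        by (intro suminf_finite) auto
      also have "\<dots> = emeasure (distr M borel (partial_sum X (\<tau> \<omega>))) B"
        using \<omega> by (subst emeasure_distr) (auto intro!: arg_cong[where f="emeasure M"])
      finally show "(\<Sum>n. emeasure M {\<omega>\<in>space M. partial_sum X n \<omega> \<in> B} * indicator {\<omega>\<in>space M. \<tau> \<omega> = n} \<omega>)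
          = emeasure (distr M borel (partial_sum X (\<tau> \<omega>))) B" .
    qed
    also have "\<dots> = emeasure (distr M (count_space UNIV) \<tau> \<bind> (\<lambda>n. distr M borel (partial_sum X n))) B"
      by (subst emeasure_bind[OF _ kernel B]) (auto simp: not_empty nn_integral_distr)
    finally show "emeasure (random_sum_distr M X \<tau>) B
        = emeasure (distr M (count_space UNIV) \<tau> \<bind> (\<lambda>n. distr M borel (partial_sum X n))) B" .
  qed
qed

text \<open>Independence in the form used below: the number of summands is read at
  \<open>\<omega>\<close> and the summands at a separate point \<open>\<omega>'\<close>, so the
  inner integral concerns a sum of fixed length.\<close>

lemma (in prob_space) nn_integral_random_sum_distr:
  fixes X :: "nat \<Rightarrow> 'a \<Rightarrow> real" and \<tau> :: "'a \<Rightarrow> nat"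
  assumes rv: "\<And>n. n \<ge> 1 \<Longrightarrow> X n \<in> borel_measurable M"
    and \<tau>[measurable]: "\<tau> \<in> measurable M (count_space UNIV)"
    and indep: "indep_of_sequence M \<tau> X"
    and \<phi>[measurable]: "\<phi> \<in> borel_measurable borel"
  shows "(\<integral>\<^sup>+x. \<phi> x \<partial>random_sum_distr M X \<tau>) = (\<integral>\<^sup>+\<omega>. (\<integral>\<^sup>+\<omega>'. \<phi> (partial_sum X (\<tau> \<omega>) \<omega>') \<partial>M) \<partial>M)"
proof -
  have S[measurable]: "partial_sum X n \<in> borel_measurable M" for n
    unfolding partial_sum_def using rv by (intro borel_measurable_sum) auto
  have kernel: "(\<lambda>n. distr M borel (partial_sum X n)) \<in> measurable (distr M (count_space UNIV) \<tau>) (subprob_algebra borel)"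
    by (auto simp: space_subprob_algebra intro!: prob_space_imp_subprob_space prob_space_distr)
  have "random_sum_distr M X \<tau> = distr M (count_space UNIV) \<tau> \<bind> (\<lambda>n. distr M borel (partial_sum X n))"
    using assms(1-3) by (rule random_sum_distr_eq_bind)
  then show ?thesis
    by (simp only: nn_integral_bind[OF \<phi> kernel]) (simp add: nn_integral_distr)
qed

section \<open>The lower bound\<close>

lemma tendsto_tail_at_top:
  assumes "prob_space F" "sets F = sets borel"
  shows "(tail F \<longlongrightarrow> 0) at_top"
proof -
  interpret real_distribution F
    using assms by (simp add: real_distribution_def real_distribution_axioms_def)
  have "tail F x = 1 - cdf F x" for x
  proof -
    have "{x<..} = space F - {..x}" by auto
    then show ?thesis unfolding tail_def cdf_def using prob_compl[of "{..x}"] by simp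
  qed
  then have "tail F = (\<lambda>x. 1 - cdf F x)" by (rule ext)
  then show ?thesis
    using tendsto_diff[OF tendsto_const[of 1] cdf_lim_at_top_prob] by simp
qed

text \<open>A sum of nonnegative terms that is at most \<open>x\<close> has all its terms at most
  \<open>x\<close>, an event of probability \<open>(1 - tail F x) ^ n\<close>. Factoring the
  complementary probability as a geometric sum exhibits \<open>tail F x\<close>, ready for
  division.\<close>

lemma (in prob_space) tail_iid_sum_ge:
  fixes X :: "nat \<Rightarrow> 'a \<Rightarrow> real"
  assumes indep: "indep_vars (\<lambda>_. borel) X {1..n}"
    and distr: "\<And>i. i \<in> {1..n} \<Longrightarrow> distr M borel (X i) = F"
    and nonneg: "AE x in F. 0 \<le> x" and "0 \<le> x"
  shows "tail F x * (\<Sum>i<n. (1 - tail F x) ^ i) \<le> prob {\<omega>\<in>space M. x < (\<Sum>i=1..n. X i \<omega>)}"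
proof (cases "n = 0")
  case False
  have rv[measurable]: "X i \<in> borel_measurable M" if "i \<in> {1..n}" for i
    using indep that by (auto simp: indep_vars_def)
  have AE_nonneg: "AE \<omega> in M. 0 \<le> X i \<omega>" if "i \<in> {1..n}" for i
  proof -
    have "AE x in distr M borel (X i). 0 \<le> x"
      unfolding distr[OF that] by (rule nonneg)
    then show ?thesis using rv[OF that] by (simp add: AE_distr_iff)
  qed
  then have AE_all: "AE \<omega> in M. \<forall>i\<in>{1..n}. 0 \<le> X i \<omega>"
    by (simp add: AE_finite_all)
  have le_prob: "prob (X i -` {..x} \<inter> space M) = 1 - tail F x" if i: "i \<in> {1..n}" for i
  proof -
    have "tail F x = prob (X i -` {x<..} \<inter> space M)"
      unfolding tail_def distr[OF i, symmetric] using rv[OF i] by (subst measure_distr) auto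
    also have "X i -` {x<..} \<inter> space M = space M - (X i -` {..x} \<inter> space M)" by auto
    also have "prob \<dots> = 1 - prob (X i -` {..x} \<inter> space M)"
      using rv[OF i] by (intro prob_compl) auto
    finally show ?thesis by simp
  qed
  have sum_meas[measurable]: "(\<lambda>\<omega>. \<Sum>i=1..n. X i \<omega>) \<in> borel_measurable M"
    by (intro borel_measurable_sum rv)
  have "prob {\<omega>\<in>space M. \<not> x < (\<Sum>i=1..n. X i \<omega>)} \<le> prob (\<Inter>i\<in>{1..n}. X i -` {..x} \<inter> space M)"
  proof (rule finite_measure_mono_AE)
    show "AE \<omega> in M. \<omega> \<in> {\<omega>\<in>space M. \<not> x < (\<Sum>i=1..n. X i \<omega>)} \<longrightarrow> \<omega> \<in> (\<Inter>i\<in>{1..n}. X i -` {..x} \<inter> space M)"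
      using AE_all
    proof eventually_elim
      case (elim \<omega>)
      then have "X i \<omega> \<le> (\<Sum>i=1..n. X i \<omega>)" if "i \<in> {1..n}" for i
        using that by (intro member_le_sum) auto
      then show ?case by fastforce
    qed
    show "(\<Inter>i\<in>{1..n}. X i -` {..x} \<inter> space M) \<in> events"
      using False rv by (intro sets.finite_INT measurable_sets[OF rv]) auto
  qed
  also have "\<dots> = (\<Prod>i\<in>{1..n}. prob (X i -` {..x} \<inter> space M))"
    using False by (intro indep_varsD_finite[OF indep]) auto
  also have "\<dots> = (1 - tail F x) ^ n" by (simp add: le_prob)
  finally have "1 - prob {\<omega>\<in>space M. x < (\<Sum>i=1..n. X i \<omega>)} \<le> (1 - tail F x) ^ n"
    by (subst (asm) prob_neg) auto
  moreover have "1 - (1 - tail F x) ^ n = tail F x * (\<Sum>i<n. (1 - tail F x) ^ i)"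
    by (simp add: one_diff_power_eq)
  ultimately show ?thesis by linarith
qed simp

lemma (in prob_space) tail_random_sum_distr:
  fixes X :: "nat \<Rightarrow> 'a \<Rightarrow> real" and \<tau> :: "'a \<Rightarrow> nat"
  assumes rv: "\<And>n. n \<ge> 1 \<Longrightarrow> X n \<in> borel_measurable M"
    and \<tau>[measurable]: "\<tau> \<in> measurable M (count_space UNIV)"
    and indep: "indep_of_sequence M \<tau> X"
  shows "tail (random_sum_distr M X \<tau>) x
    = expectation (\<lambda>\<omega>. prob {\<omega>'\<in>space M. x < (\<Sum>i=1..\<tau> \<omega>. X i \<omega>')})"
proof -
  have [measurable]: "partial_sum X n \<in> borel_measurable M" for n
    unfolding partial_sum_def using rv by (intro borel_measurable_sum) auto
  have comp: "(\<lambda>\<omega>. q (\<tau> \<omega>)) \<in> borel_measurable M" for q :: "nat \<Rightarrow> real"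
    by (rule measurable_compose[OF \<tau>]) simp
  let ?q = "\<lambda>n. prob {\<omega>'\<in>space M. x < partial_sum X n \<omega>'}"
  have "emeasure (random_sum_distr M X \<tau>) {x<..} = (\<integral>\<^sup>+y. indicator {x<..} y \<partial>random_sum_distr M X \<tau>)"
    by (simp add: random_sum_distr_def)
  also have "\<dots> = (\<integral>\<^sup>+\<omega>. (\<integral>\<^sup>+\<omega>'. indicator {x<..} (partial_sum X (\<tau> \<omega>) \<omega>') \<partial>M) \<partial>M)"
    by (rule nn_integral_random_sum_distr[OF rv \<tau> indep]) auto
  also have "\<dots> = (\<integral>\<^sup>+\<omega>. ennreal (?q (\<tau> \<omega>)) \<partial>M)"
  proof (intro nn_integral_cong)
    fix \<omega>
    have "(\<integral>\<^sup>+\<omega>'. indicator {x<..} (partial_sum X (\<tau> \<omega>) \<omega>') \<partial>M)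
        = (\<integral>\<^sup>+\<omega>'. indicator {\<omega>'\<in>space M. x < partial_sum X (\<tau> \<omega>) \<omega>'} \<omega>' \<partial>M)"
      by (intro nn_integral_cong) (auto simp: indicator_def)
    then show "(\<integral>\<^sup>+\<omega>'. indicator {x<..} (partial_sum X (\<tau> \<omega>) \<omega>') \<partial>M) = ennreal (?q (\<tau> \<omega>))"
      by (simp add: emeasure_eq_measure)
  qed
  also have "\<dots> = ennreal (expectation (\<lambda>\<omega>. ?q (\<tau> \<omega>)))"
    by (intro nn_integral_eq_integral integrable_const_bound[where B=1] comp) auto
  finally show ?thesis
    by (simp add: tail_def measure_def partial_sum_def integral_nonneg_AE)
qed

lemma (in prob_space) Liminf_tail_random_sum_ge:
  fixes X :: "nat \<Rightarrow> 'a \<Rightarrow> real" and \<tau> :: "'a \<Rightarrow> nat"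
  assumes indep_X: "indep_vars (\<lambda>_. borel) X {1..}"
    and distr: "\<And>n. n \<ge> 1 \<Longrightarrow> distr M borel (X n) = F"
    and \<tau>[measurable]: "\<tau> \<in> measurable M (count_space UNIV)"
    and indep: "indep_of_sequence M \<tau> X"
    and nonneg: "AE x in F. 0 \<le> x"
    and pos: "\<And>x. 0 < tail F x"
    and int: "integrable M (\<lambda>\<omega>. real (\<tau> \<omega>))"
  shows "ereal (expectation (\<lambda>\<omega>. real (\<tau> \<omega>)))
    \<le> Liminf at_top (\<lambda>x. ereal (tail (random_sum_distr M X \<tau>) x / tail F x))"
proof -
  have rv: "X n \<in> borel_measurable M" if "n \<ge> 1" for n
    using indep_X that by (auto simp: indep_vars_def)
  have F: "prob_space F" "sets F = sets borel"
    using prob_space_distr[OF rv[of 1]] distr[of 1] by auto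
  interpret F: prob_space F by fact
  have comp: "(\<lambda>\<omega>. q (\<tau> \<omega>)) \<in> borel_measurable M" for q :: "nat \<Rightarrow> real"
    by (rule measurable_compose[OF \<tau>]) simp
  \<comment> \<open>The lower bound for the ratio of tails given \<open>n\<close> summands. It lies
    between 0 and \<open>n\<close> and tends to \<open>n\<close> as \<open>tail F x\<close> tends to
    0, so \<open>\<tau>\<close> is an integrable majorant.\<close>
  define L where "L x n = (\<Sum>i<n. (1 - tail F x) ^ i)" for x :: real and n :: nat
  have tail_01: "0 \<le> 1 - tail F x" "1 - tail F x \<le> 1" for x
    by (auto simp: tail_def)
  have L: "0 \<le> L x n" "L x n \<le> real n" for x n
  proof -
    show "0 \<le> L x n" unfolding L_def using tail_01 by (intro sum_nonneg) auto
    have "L x n \<le> (\<Sum>i<n. 1)" unfolding L_def using tail_01 by (intro sum_mono power_le_one) auto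
    then show "L x n \<le> real n" by simp
  qed
  have int_L: "integrable M (\<lambda>\<omega>. L x (\<tau> \<omega>))" for x
    by (rule Bochner_Integration.integrable_bound[OF int comp]) (use L in \<open>auto simp: abs_of_nonneg\<close>)
  have lim: "((\<lambda>x. expectation (\<lambda>\<omega>. L x (\<tau> \<omega>))) \<longlongrightarrow> expectation (\<lambda>\<omega>. real (\<tau> \<omega>))) at_top"
  proof (rule integral_dominated_convergence_at_top[where w="\<lambda>\<omega>. real (\<tau> \<omega>)"])
    have "((\<lambda>x. L x n) \<longlongrightarrow> (\<Sum>i<n. (1 - 0) ^ i)) at_top" for n
      unfolding L_def by (intro tendsto_intros tendsto_tail_at_top F)
    then show "AE \<omega> in M. ((\<lambda>x. L x (\<tau> \<omega>)) \<longlongrightarrow> real (\<tau> \<omega>)) at_top" by simp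
    show "\<forall>\<^sub>F x in at_top. AE \<omega> in M. norm (L x (\<tau> \<omega>)) \<le> real (\<tau> \<omega>)"
      using L by (intro always_eventually allI AE_I2) simp
  qed (use int comp in auto)
  have ge: "expectation (\<lambda>\<omega>. L x (\<tau> \<omega>)) \<le> tail (random_sum_distr M X \<tau>) x / tail F x" if "0 \<le> x" for x
  proof -
    have "tail F x * expectation (\<lambda>\<omega>. L x (\<tau> \<omega>)) = expectation (\<lambda>\<omega>. tail F x * L x (\<tau> \<omega>))" by simp
    also have "\<dots> \<le> expectation (\<lambda>\<omega>. prob {\<omega>'\<in>space M. x < (\<Sum>i=1..\<tau> \<omega>. X i \<omega>')})"
    proof (rule integral_mono)
      show "integrable M (\<lambda>\<omega>. prob {\<omega>'\<in>space M. x < (\<Sum>i=1..\<tau> \<omega>. X i \<omega>')})"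
        by (rule integrable_const_bound[where B=1], simp, rule comp)
      show "tail F x * L x (\<tau> \<omega>) \<le> prob {\<omega>'\<in>space M. x < (\<Sum>i=1..\<tau> \<omega>. X i \<omega>')}" for \<omega>
        unfolding L_def
        by (rule tail_iid_sum_ge[OF indep_vars_subset[OF indep_X] distr nonneg that]) auto
    qed (use int_L in auto)
    also have "\<dots> = tail (random_sum_distr M X \<tau>) x"
      by (rule tail_random_sum_distr[symmetric, OF rv \<tau> indep])
    finally show ?thesis using pos[of x] by (simp add: pos_le_divide_eq mult.commute)
  qed
  have "ereal (expectation (\<lambda>\<omega>. real (\<tau> \<omega>))) = Liminf at_top (\<lambda>x. ereal (expectation (\<lambda>\<omega>. L x (\<tau> \<omega>))))"
    using lim by (intro lim_imp_Liminf[symmetric]) auto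
  also have "\<dots> \<le> Liminf at_top (\<lambda>x. ereal (tail (random_sum_distr M X \<tau>) x / tail F x))"
    using ge by (intro Liminf_mono eventually_mono[OF eventually_ge_at_top[of 0]]) simp
  finally show ?thesis .
qed

section \<open>The upper bound\<close>

lemma (in prob_space) random_sum_tail_factor_le:
  fixes X :: "nat \<Rightarrow> 'a \<Rightarrow> real" and \<tau> :: "'a \<Rightarrow> nat" and G :: "real \<Rightarrow> real"
  assumes indep_X: "indep_vars (\<lambda>_. borel) X {1..}"
    and distr: "\<And>n. n \<ge> 1 \<Longrightarrow> distr M borel (X n) = F"
    and \<tau>[measurable]: "\<tau> \<in> measurable M (count_space UNIV)"
    and indep: "indep_of_sequence M \<tau> X"
    and int_\<tau>: "integrable M (\<lambda>\<omega>. real (\<tau> \<omega>))"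
    and nonneg: "AE x in F. 0 \<le> x" and int: "integrable F (\<lambda>x. x)" and heavy: "heavy_tailed F"
    and c: "(\<integral>x. x \<partial>F) < c"
    and G: "concave_on {0..} G" "mono G" "continuous_on UNIV G" "G 0 = 0"
    and top: "(\<integral>\<^sup>+x. ennreal (x * exp (G x)) \<partial>F) = \<infinity>"
    and dom: "(\<integral>\<^sup>+\<omega>. ennreal (real (\<tau> \<omega>) * exp (G (c * real (\<tau> \<omega>)))) \<partial>M) < \<infinity>"
    and \<rho>: "0 \<le> \<rho>" and x0: "0 \<le> x0"
    and ge: "\<And>x. x0 \<le> x \<Longrightarrow> \<rho> * tail F x \<le> tail (random_sum_distr M X \<tau>) x"
  shows "\<rho> \<le> expectation (\<lambda>\<omega>. real (\<tau> \<omega>))"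
proof (rule field_le_epsilon)
  fix e :: real assume e: "0 < e"
  have rv: "X n \<in> borel_measurable M" if "n \<ge> 1" for n
    using indep_X that by (auto simp: indep_vars_def)
  have F: "prob_space F" "sets F = sets borel"
    using prob_space_distr[OF rv[of 1]] distr[of 1] by auto
  note [measurable_cong] = F(2)
  have S[measurable]: "partial_sum X n \<in> borel_measurable M" for n
    unfolding partial_sum_def using rv by (intro borel_measurable_sum) auto
  have comp: "(\<lambda>\<omega>. q (\<tau> \<omega>)) \<in> borel_measurable M" for q :: "nat \<Rightarrow> real"
    by (rule measurable_compose[OF \<tau>]) simp
  have rsd: "prob_space (random_sum_distr M X \<tau>)" "sets (random_sum_distr M X \<tau>) = sets borel"
  proof -
    have "(\<lambda>\<omega>. partial_sum X (\<tau> \<omega>) \<omega>) \<in> borel_measurable M"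
      by (rule measurable_compose_countable[OF _ \<tau>]) (rule S)
    then show "prob_space (random_sum_distr M X \<tau>)"
      unfolding random_sum_distr_def by (rule prob_space_distr)
  qed (simp add: random_sum_distr_def)
  have G_nonneg: "0 \<le> G x" if "0 \<le> x" for x using monoD[OF G(2) that] G(4) by simp
  have "0 \<le> (\<integral>x. x \<partial>F)" using nonneg by (rule integral_nonneg_AE)
  with c have "0 < c" by simp
  \<comment> \<open>Bounds the test function at \<open>x0\<close> for all \<open>j\<close> at once,
    since the slopes \<open>\<theta> j\<close> are at most 1.\<close>
  define D where "D = x0 * exp x0"
  \<comment> \<open>The first bound is what the choice of a truncation level requires;
    \<open>\<rho> * D / e\<close> makes the additive error at most \<open>e\<close> after division
    by an integral that is at least \<open>K\<close>.\<close>
  define K where "K = max (max (\<integral>x. x \<partial>F) 1) (\<rho> * D / e)"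
  have K: "(\<integral>x. x \<partial>F) \<le> K" "0 < K" "\<rho> * D / K \<le> e"
  proof -
    show "(\<integral>x. x \<partial>F) \<le> K" "0 < K" by (auto simp: K_def)
    moreover have "\<rho> * D / e \<le> K" by (simp add: K_def)
    ultimately show "\<rho> * D / K \<le> e" using e by (simp add: pos_divide_le_eq mult.commute)
  qed
  have eK: "0 \<le> exp 1 * K" using K(2) by simp
  \<comment> \<open>The threshold is fixed for the constant \<open>exp 1 * K\<close>, which will
    bound the integrals for every \<open>j\<close>, before the slopes are sent to 0.\<close>
  obtain \<theta>\<^sub>0 where \<theta>\<^sub>0: "0 < \<theta>\<^sub>0" and exp_moment:
    "\<And>\<theta> h. \<lbrakk>0 \<le> \<theta>; \<theta> \<le> \<theta>\<^sub>0; h \<in> borel_measurable borel; \<And>x. 0 \<le> x \<Longrightarrow> 0 \<le> h x \<and> h x \<le> \<theta> * x;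
        (\<integral>\<^sup>+x. ennreal (x * exp (h x)) \<partial>F) \<le> ennreal (exp 1 * K)\<rbrakk>
      \<Longrightarrow> (\<integral>\<^sup>+x. ennreal (exp (h x)) \<partial>F) \<le> ennreal (exp (\<theta> * c))"
    by (rule exp_moment_le[OF F nonneg int c eK]) blast
  define \<theta> where "\<theta> j = min (min \<theta>\<^sub>0 1) (inverse (real (Suc j)))" for j :: nat
  have \<theta>: "0 < \<theta> j" "\<theta> j \<le> \<theta>\<^sub>0" "\<theta> j \<le> 1" "\<theta> j \<le> inverse (real (Suc j))" for j
    using \<theta>\<^sub>0 by (auto simp: \<theta>_def)
  define J where "J j s = (\<integral>\<^sup>+x. ennreal (x * exp (min (min (\<theta> j * x) (G x)) (real s))) \<partial>F)" for j s :: nat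
  have "\<exists>s. ennreal K \<le> J j s \<and> J j s \<le> ennreal (exp 1 * K)" for j
  proof -
    have top_j: "(\<integral>\<^sup>+x. ennreal (x * exp (min (\<theta> j * x) (G x))) \<partial>F) = \<infinity>"
      by (rule nn_integral_exp_min_linear_eq_top[OF F nonneg heavy G(1,2,4) top \<theta>(1)])
    have meas: "(\<lambda>x. min (\<theta> j * x) (G x)) \<in> borel_measurable borel"
      using borel_measurable_mono[OF G(2)] by simp
    have H: "0 \<le> min (\<theta> j * x) (G x)" if "0 \<le> x" for x
      using that \<theta>(1)[of j] G_nonneg by simp
    show ?thesis
      unfolding J_def
      by (rule truncation_level_exists[OF F nonneg int meas H top_j K(1) less_imp_le[OF K(2)]]) blast+
  qed
  then obtain s where s: "\<And>j. ennreal K \<le> J j (s j)" "\<And>j. J j (s j) \<le> ennreal (exp 1 * K)"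
    by metis
  define h where "h j x = min (min (\<theta> j * x) (G x)) (real (s j))" for j x
  have h_conc: "concave_on {0..} (h j)" for j
    unfolding h_def using \<theta>(1)[of j] G(1)
    by (auto intro!: concave_on_min concave_on_cmul simp: concave_on_ident concave_on_const)
  have h_mono: "mono (h j)" for j
    unfolding h_def using \<theta>(1)[of j] monoD[OF G(2)] by (intro monoI min.mono mult_left_mono) auto
  have h0: "h j 0 = 0" for j using G(4) by (simp add: h_def)
  have h_cont: "continuous_on UNIV (h j)" for j
    unfolding h_def by (intro continuous_intros G(3))
  have h_nonneg: "0 \<le> h j x" if "0 \<le> x" for j x using monoD[OF h_mono that, of j] h0 by simp
  have h_le: "h j x \<le> \<theta> j * x" "h j x \<le> G x" for j x by (auto simp: h_def)
  have [measurable]: "h j \<in> borel_measurable borel" for j using h_mono by (rule borel_measurable_mono)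
  define E where "E j = expectation (\<lambda>\<omega>. real (\<tau> \<omega>) * exp (h j (c * real (\<tau> \<omega>))))" for j
  have int_dom: "integrable M (\<lambda>\<omega>. real (\<tau> \<omega>) * exp (G (c * real (\<tau> \<omega>))))"
    using dom by (intro integrableI_nonneg comp) auto
  have bound: "norm (real n * exp (h j (c * real n))) \<le> real n * exp (G (c * real n))" for j n
    using h_le(2)[of j "c * real n"] by (simp add: mult_left_mono)
  have int_E: "integrable M (\<lambda>\<omega>. real (\<tau> \<omega>) * exp (h j (c * real (\<tau> \<omega>))))" for j
    using bound by (intro Bochner_Integration.integrable_bound[OF int_dom comp]) (auto simp: abs_mult)
  \<comment> \<open>The truncation levels \<open>s j\<close> are uncontrolled, but
    \<open>h j \<le> \<theta> j * x\<close> forces pointwise convergence to 0, and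
    \<open>h j \<le> G\<close> gives the majorant.\<close>
  have E_lim: "E \<longlonglongrightarrow> expectation (\<lambda>\<omega>. real (\<tau> \<omega>))"
    unfolding E_def
  proof (rule integral_dominated_convergence[OF comp comp int_dom])
    show "AE \<omega> in M. (\<lambda>j. real (\<tau> \<omega>) * exp (h j (c * real (\<tau> \<omega>)))) \<longlonglongrightarrow> real (\<tau> \<omega>)"
    proof (rule AE_I2)
      fix \<omega>
      let ?y = "c * real (\<tau> \<omega>)"
      have y: "0 \<le> ?y" using \<open>0 < c\<close> by simp
      have "(\<lambda>j. h j ?y) \<longlonglongrightarrow> 0"
      proof (rule tendsto_sandwich[where f="\<lambda>_. 0" and h="\<lambda>j. inverse (real (Suc j)) * ?y"])
        show "(\<lambda>j. inverse (real (Suc j)) * ?y) \<longlonglongrightarrow> 0"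
          using tendsto_mult_left_zero[OF LIMSEQ_inverse_real_of_nat] .
        show "\<forall>\<^sub>F j in sequentially. h j ?y \<le> inverse (real (Suc j)) * ?y"
          using h_le(1) mult_right_mono[OF \<theta>(4) y] by (intro always_eventually allI) (rule order_trans)
      qed (use h_nonneg y in auto)
      then have "(\<lambda>j. real (\<tau> \<omega>) * exp (h j ?y)) \<longlonglongrightarrow> real (\<tau> \<omega>) * exp 0"
        by (intro tendsto_intros)
      then show "(\<lambda>j. real (\<tau> \<omega>) * exp (h j ?y)) \<longlonglongrightarrow> real (\<tau> \<omega>)" by simp
    qed
  qed (use bound in auto)
  have "\<rho> \<le> E j + e" for j
  proof -
    \<comment> \<open>The exact value \<open>I\<close> appears on both sides of the comparison and
      cancels. Its upper bound is used for the exponential moments, its lower bound for the additive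
      error.\<close>
    obtain I where I: "(\<integral>\<^sup>+x. ennreal (x * exp (h j x)) \<partial>F) = ennreal I" and I_pos: "0 \<le> I"
    proof (cases "\<integral>\<^sup>+x. ennreal (x * exp (h j x)) \<partial>F")
      case (real r)
      then show ?thesis using that by blast
    next
      case top
      then show ?thesis using s(2)[of j] by (simp add: J_def h_def top_unique)
    qed
    have I_bounds: "K \<le> I" "I \<le> exp 1 * K"
      using s(1,2)[of j] I_pos eK by (simp_all add: J_def h_def[symmetric] I)
    \<comment> \<open>Replacing \<open>x\<close> by \<open>max x 0\<close> makes the test function
      monotone and nonnegative on the whole line; under \<open>ennreal\<close> nothing changes, as
      negative values become 0.\<close>
    define \<phi> where "\<phi> x = max x 0 * exp (h j x)" for x
    have \<phi>: "mono \<phi>" "continuous_on UNIV \<phi>" "\<And>x. 0 \<le> \<phi> x"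
      unfolding \<phi>_def
      by (auto intro!: monoI mult_mono continuous_intros h_cont monoD[OF h_mono])
    have ennreal_\<phi>: "ennreal (\<phi> x) = ennreal (x * exp (h j x))" for x
      by (cases "0 \<le> x") (auto simp: \<phi>_def ennreal_neg mult_nonpos_nonneg)
    have \<phi>_x0: "\<phi> x0 \<le> D"
    proof -
      have "h j x0 \<le> 1 * x0" using h_le(1)[of j x0] mult_right_mono[OF \<theta>(3)[of j] x0] by (rule order_trans)
      then show ?thesis using x0 unfolding \<phi>_def D_def by (simp add: max_absorb1 mult_left_mono)
    qed
    have sum_le: "(\<integral>\<^sup>+\<omega>'. ennreal (\<phi> (partial_sum X n \<omega>')) \<partial>M) \<le> ennreal (I * (real n * exp (h j (c * real n))))" for n
      unfolding ennreal_\<phi> partial_sum_def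
    \<comment> \<open>The bounds \<open>\<theta> j\<close> and \<open>I\<close> take the places of
      \<open>\<theta>\<^sub>0\<close> and \<open>exp 1 * K\<close>. Both are no larger, so the
      moment estimate still applies.\<close>
    proof (rule nn_integral_iid_sum_exp_concave_le[where \<theta>\<^sub>0="\<theta> j" and F=F])
      show "indep_vars (\<lambda>_. borel) X {1..n}" by (rule indep_vars_subset[OF indep_X]) auto
      fix \<theta>' k
      assume *: "0 \<le> \<theta>'" "\<theta>' \<le> \<theta> j" "k \<in> borel_measurable borel"
        "\<And>x. 0 \<le> x \<Longrightarrow> 0 \<le> k x \<and> k x \<le> \<theta>' * x"
        "(\<integral>\<^sup>+x. ennreal (x * exp (k x)) \<partial>F) \<le> ennreal I"
      have "\<theta>' \<le> \<theta>\<^sub>0" using *(2) \<theta>(2)[of j] by simp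
      moreover have "(\<integral>\<^sup>+x. ennreal (x * exp (k x)) \<partial>F) \<le> ennreal (exp 1 * K)"
        using *(5) ennreal_leI[OF I_bounds(2)] by (rule order_trans)
      ultimately show "(\<integral>\<^sup>+x. ennreal (exp (k x)) \<partial>F) \<le> ennreal (exp (\<theta>' * c))"
        using * by (intro exp_moment)
    next
      show "h j x \<le> \<theta> j * x" if "0 \<le> x" for x by (rule h_le)
    qed (use distr nonneg h_conc h_mono h0 I I_pos \<open>0 < c\<close> in simp_all)
    \<comment> \<open>Testing both tails against \<open>\<phi>\<close> leads to
      \<open>\<rho> * I \<le> I * E j + \<rho> * D\<close>, to be divided by
      \<open>I\<close>.\<close>
    have "ennreal (\<rho> * I) = ennreal \<rho> * (\<integral>\<^sup>+x. ennreal (\<phi> x) \<partial>F)"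
      using \<rho> I_pos by (simp add: ennreal_\<phi> I ennreal_mult)
    also have "\<dots> \<le> (\<integral>\<^sup>+x. ennreal (\<phi> x) \<partial>random_sum_distr M X \<tau>) + ennreal (\<rho> * \<phi> x0)"
      using ge unfolding tail_def by (intro nn_integral_tail_dominated rsd F \<phi> \<rho>)
    also have "\<dots> \<le> ennreal (I * E j) + ennreal (\<rho> * D)"
    proof (rule add_mono)
      have "(\<integral>\<^sup>+x. ennreal (\<phi> x) \<partial>random_sum_distr M X \<tau>)
          = (\<integral>\<^sup>+\<omega>. (\<integral>\<^sup>+\<omega>'. ennreal (\<phi> (partial_sum X (\<tau> \<omega>) \<omega>')) \<partial>M) \<partial>M)"
        using rv \<tau> indep borel_measurable_mono[OF \<phi>(1)]
        by (intro nn_integral_random_sum_distr measurable_compose[OF _ measurable_ennreal])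
      also have "\<dots> \<le> (\<integral>\<^sup>+\<omega>. ennreal (I * (real (\<tau> \<omega>) * exp (h j (c * real (\<tau> \<omega>))))) \<partial>M)"
        by (intro nn_integral_mono sum_le)
      also have "\<dots> = ennreal (\<integral>\<omega>. I * (real (\<tau> \<omega>) * exp (h j (c * real (\<tau> \<omega>)))) \<partial>M)"
        using I_pos int_E[of j] by (intro nn_integral_eq_integral) auto
      also have "\<dots> = ennreal (I * E j)" by (simp add: E_def)
      finally show "(\<integral>\<^sup>+x. ennreal (\<phi> x) \<partial>random_sum_distr M X \<tau>) \<le> ennreal (I * E j)" .
      show "ennreal (\<rho> * \<phi> x0) \<le> ennreal (\<rho> * D)"
        using \<phi>_x0 \<rho> by (intro ennreal_leI mult_left_mono)
    qed
    also have "\<dots> = ennreal (I * E j + \<rho> * D)"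
    proof (rule ennreal_plus[symmetric])
      have "0 \<le> E j" unfolding E_def by (intro integral_nonneg_AE AE_I2) simp
      then show "0 \<le> I * E j" "0 \<le> \<rho> * D" using I_pos \<rho> x0 by (auto simp: D_def)
    qed
    finally have "ennreal (\<rho> * I) \<le> ennreal (I * E j + \<rho> * D)" .
    moreover have "0 \<le> I * E j + \<rho> * D"
      unfolding E_def D_def using I_pos \<rho> x0 by (intro add_nonneg_nonneg mult_nonneg_nonneg integral_nonneg_AE AE_I2) auto
    ultimately have "\<rho> * I \<le> I * E j + \<rho> * D" by (simp add: ennreal_le_iff)
    also have "\<rho> * D \<le> e * I"
    proof -
      have "\<rho> * D \<le> e * K" using K(2,3) by (simp add: pos_divide_le_eq)
      also have "\<dots> \<le> e * I" using e I_bounds(1) by (intro mult_left_mono) auto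
      finally show ?thesis .
    qed
    finally have "\<rho> * I \<le> (E j + e) * I" by (simp add: algebra_simps)
    then show ?thesis using I_bounds(1) K(2) by simp
  qed
  then have "\<rho> - e \<le> E j" for j by (simp add: algebra_simps)
  then have "\<rho> - e \<le> expectation (\<lambda>\<omega>. real (\<tau> \<omega>))"
    by (intro LIMSEQ_le_const[OF E_lim]) auto
  then show "\<rho> \<le> expectation (\<lambda>\<omega>. real (\<tau> \<omega>)) + e" by simp
qed

section \<open>Combining the two bounds\<close>

theorem theorem2:
  fixes M :: "'a measure" and F :: "real measure"
    and \<xi> :: "'a \<Rightarrow> real" and X :: "nat \<Rightarrow> 'a \<Rightarrow> real" and \<tau> :: "'a \<Rightarrow> nat"
    and f :: "real \<Rightarrow> real" and c :: real
  assumes "prob_space M"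
    and "\<xi> \<in> borel_measurable M" and "distr M borel \<xi> = F"
    and "prob_space.indep_vars M (\<lambda>_. borel) X {1..}"
    and "\<And>n. n \<ge> 1 \<Longrightarrow> distr M borel (X n) = F"
    and "\<tau> \<in> measurable M (count_space UNIV)"
    and "indep_of_sequence M \<tau> X"
    and "\<And>x. tail F x > 0"
    and "integrable M (\<lambda>\<omega>. real (\<tau> \<omega>))"
    and "AE \<omega> in M. \<xi> \<omega> \<ge> 0"
    and "heavy_tailed F"
    and "integrable M \<xi>"
    and "\<And>b. bdd_above (f ` {0..b})"
    and "(\<integral>\<^sup>+ \<omega>. ennreal (exp (f (\<xi> \<omega>))) \<partial>M) = \<infinity>"
    and "c > prob_space.expectation M \<xi>"
    and "(\<integral>\<^sup>+ \<omega>. ennreal (exp (f (c * real (\<tau> \<omega>)))) \<partial>M) < \<infinity>"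
    and "eventually (\<lambda>x. f x \<ge> ln x) at_top"
    and "eventually_concave (\<lambda>x. f x - ln x)"
  shows "Liminf at_top (\<lambda>x. ereal (tail (random_sum_distr M X \<tau>) x / tail F x))
           = ereal (prob_space.expectation M (\<lambda>\<omega>. real (\<tau> \<omega>)))"
proof -
  interpret prob_space M by fact
  note [measurable] = assms(2,6)
  have F: "prob_space F" "sets F = sets borel"
    using prob_space_distr[OF assms(2)] assms(3) by auto
  interpret F: prob_space F by fact
  have F_eq: "F = distr M borel \<xi>" using assms(3) by simp
  have nonneg: "AE x in F. 0 \<le> x"
    unfolding F_eq using assms(10) by (simp add: AE_distr_iff)
  have int: "integrable F (\<lambda>x. x)"
    unfolding F_eq using assms(12) by (simp add: integrable_distr_eq)
  have mean: "(\<integral>x. x \<partial>F) = expectation \<xi>"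
    unfolding F_eq by (simp add: integral_distr)
  have c: "(\<integral>x. x \<partial>F) < c" using assms(15) mean by simp
  have "0 \<le> (\<integral>x. x \<partial>F)" using nonneg by (rule integral_nonneg_AE)
  with c have c_pos: "0 < c" by simp
  obtain G A C where G: "concave_on {0..} G" "mono G" "continuous_on UNIV G" "G 0 = 0"
    and AC: "0 \<le> A" "0 \<le> C"
    and f_le: "\<And>x. 0 \<le> x \<Longrightarrow> exp (f x) \<le> A + C * (x * exp (G x))"
    and G_le: "\<And>x. 0 \<le> x \<Longrightarrow> x * exp (G x) \<le> A + C * exp (f x)"
    using eventually_concave_comparison[OF assms(13,17,18)] by blast
  have [measurable]: "G \<in> borel_measurable borel" using G(2) by (rule borel_measurable_mono)
  \<comment> \<open>The comparison \<open>f_le\<close> transfers divergence from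
    \<open>exp (f \<xi>)\<close> to the integral with \<open>G\<close>, the constant
    \<open>A\<close> being integrable under a probability measure.\<close>
  have top: "(\<integral>\<^sup>+x. ennreal (x * exp (G x)) \<partial>F) = \<infinity>"
  proof (rule ccontr)
    assume finite: "\<not> ?thesis"
    have "(\<integral>\<^sup>+\<omega>. ennreal (exp (f (\<xi> \<omega>))) \<partial>M)
        \<le> (\<integral>\<^sup>+\<omega>. ennreal A + ennreal C * ennreal (\<xi> \<omega> * exp (G (\<xi> \<omega>))) \<partial>M)"
    proof (intro nn_integral_mono_AE, use assms(10) in eventually_elim)
      case (elim \<omega>)
      have "ennreal (exp (f (\<xi> \<omega>))) \<le> ennreal (A + C * (\<xi> \<omega> * exp (G (\<xi> \<omega>))))"
        by (intro ennreal_leI f_le elim)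
      then show ?case using elim AC by (simp add: ennreal_mult)
    qed
    also have "\<dots> = ennreal A + ennreal C * (\<integral>\<^sup>+x. ennreal (x * exp (G x)) \<partial>F)"
      unfolding F_eq by (subst nn_integral_add) (auto simp: nn_integral_cmult nn_integral_distr emeasure_space_1)
    also have "\<dots> < \<infinity>" using finite by (simp add: ennreal_mult_less_top less_top)
    finally show False using assms(14) by simp
  qed
  have dom: "(\<integral>\<^sup>+\<omega>. ennreal (real (\<tau> \<omega>) * exp (G (c * real (\<tau> \<omega>)))) \<partial>M) < \<infinity>"
  proof -
    \<comment> \<open>The composition factors through the discrete space of values of
      \<open>\<tau>\<close>, where every function is measurable.\<close>
    have meas: "(\<lambda>\<omega>. ennreal (exp (f (c * real (\<tau> \<omega>))))) \<in> borel_measurable M"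
      by (rule measurable_compose[OF assms(6)]) simp
    have "(\<integral>\<^sup>+\<omega>. ennreal (real (\<tau> \<omega>) * exp (G (c * real (\<tau> \<omega>)))) \<partial>M)
        \<le> (\<integral>\<^sup>+\<omega>. ennreal (A / c) + ennreal (C / c) * ennreal (exp (f (c * real (\<tau> \<omega>)))) \<partial>M)"
    proof (intro nn_integral_mono)
      fix \<omega>
      \<comment> \<open>\<open>G_le\<close> at the point \<open>c * \<tau>\<close> carries an extra
        factor \<open>c\<close>, which is divided out.\<close>
      have "c * (real (\<tau> \<omega>) * exp (G (c * real (\<tau> \<omega>)))) \<le> A + C * exp (f (c * real (\<tau> \<omega>)))"
        using G_le[of "c * real (\<tau> \<omega>)"] c_pos by (simp add: mult.assoc)
      then have "real (\<tau> \<omega>) * exp (G (c * real (\<tau> \<omega>))) \<le> A / c + C / c * exp (f (c * real (\<tau> \<omega>)))"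
        using c_pos by (simp add: field_simps)
      then have "ennreal (real (\<tau> \<omega>) * exp (G (c * real (\<tau> \<omega>))))
          \<le> ennreal (A / c + C / c * exp (f (c * real (\<tau> \<omega>))))" by (rule ennreal_leI)
      also have "\<dots> = ennreal (A / c) + ennreal (C / c * exp (f (c * real (\<tau> \<omega>))))"
        using AC c_pos by (intro ennreal_plus) auto
      also have "ennreal (C / c * exp (f (c * real (\<tau> \<omega>)))) = ennreal (C / c) * ennreal (exp (f (c * real (\<tau> \<omega>))))"
        using AC c_pos by (intro ennreal_mult) auto
      finally show "ennreal (real (\<tau> \<omega>) * exp (G (c * real (\<tau> \<omega>))))
          \<le> ennreal (A / c) + ennreal (C / c) * ennreal (exp (f (c * real (\<tau> \<omega>))))" .
    qed
    also have "\<dots> = ennreal (A / c) + ennreal (C / c) * (\<integral>\<^sup>+\<omega>. ennreal (exp (f (c * real (\<tau> \<omega>)))) \<partial>M)"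
      using meas by (subst nn_integral_add) (auto simp: nn_integral_cmult emeasure_space_1)
    also have "\<dots> < \<infinity>" using assms(16) by (simp add: ennreal_mult_less_top)
    finally show ?thesis .
  qed
  let ?r = "\<lambda>x. ereal (tail (random_sum_distr M X \<tau>) x / tail F x)"
  show ?thesis
  proof (rule antisym)
    show "ereal (expectation (\<lambda>\<omega>. real (\<tau> \<omega>))) \<le> Liminf at_top ?r"
      using Liminf_tail_random_sum_ge[OF assms(4,5,6,7) nonneg assms(8,9)] .
    show "Liminf at_top ?r \<le> ereal (expectation (\<lambda>\<omega>. real (\<tau> \<omega>)))"
    proof (rule ccontr)
      assume "\<not> ?thesis"
      \<comment> \<open>A number strictly between the expectation and the lower limit is eventually
        exceeded by the ratio of tails, which contradicts the upper bound.\<close>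
      then obtain \<rho> where \<rho>: "expectation (\<lambda>\<omega>. real (\<tau> \<omega>)) < \<rho>" "ereal \<rho> < Liminf at_top ?r"
        using ereal_dense2[of "ereal (expectation (\<lambda>\<omega>. real (\<tau> \<omega>)))" "Liminf at_top ?r"] by (auto simp: not_le)
      have "\<forall>\<^sub>F x in at_top. ereal \<rho> < ?r x" using \<rho>(2) by (rule less_LiminfD)
      then obtain x0 where x0: "\<And>x. x0 \<le> x \<Longrightarrow> \<rho> < tail (random_sum_distr M X \<tau>) x / tail F x"
        by (auto simp: eventually_at_top_linorder)
      have "0 \<le> expectation (\<lambda>\<omega>. real (\<tau> \<omega>))" by (intro integral_nonneg_AE AE_I2) simp
      with \<rho>(1) have \<rho>_nonneg: "0 \<le> \<rho>" by linarith
      have "\<rho> * tail F x \<le> tail (random_sum_distr M X \<tau>) x" if "max x0 0 \<le> x" for x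
        using x0[of x] that assms(8)[of x] by (simp add: pos_less_divide_eq)
      then have "\<rho> \<le> expectation (\<lambda>\<omega>. real (\<tau> \<omega>))"
        by (intro random_sum_tail_factor_le[OF assms(4,5,6,7,9) nonneg int assms(11) c G top dom \<rho>_nonneg, of "max x0 0"])
          auto
      with \<rho>(1) show False by simp
    qed
  qed
qed

end
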